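(* Let $M$ be a complete metric space. Let $W\subset\mathcal{F}(M)$ be weakly precompact. Then $W$ is tight. More precisely, for every $\varepsilon>0$ there exist a compact set $K\subset M$ and a linear mapping $T:\operatorname{span}(W)\to\mathcal{F}(K)$ such that (1) $\|\mu-T\mu\|\le\varepsilon$ for all $\mu\in W$, and (2) there is a sequence of bounded linear operators $T_k:\mathcal{F}(M)\to\mathcal{F}(M)$ such that $T_k\to T$ uniformly on $W$.
   Context: All metric spaces come with a distinguished base point $0$. $\mathrm{Lip}_0(M)$ is the Banach space of real-valued Lipschitz functions $f$ on $M$ with $f(0)=0$, normed by the best Lipschitz constant $\|f\|_L$. For $x\in M$ let $\delta(x)\in\mathrm{Lip}_0(M)^*$ be $\delta(x)(f)=f(x)$. The Lipschitz-free space is $\mathcal{F}(M)=\overline{\operatorname{span}}\{\delta(x):x\in M\}\subset\mathrm{Lip}_0(M)^*$ (norm closure). For $N\subset M$, $\mathcal{F}(N)$ is identified with the closed subspace $\overline{\operatorname{span}}\{\delta(x):x\in N\}$ of $\mathcal{F}(M)$ (canonically isometric to the free space over $N\cup\{0\}$). $B_X$ denotes the closed unit ball of a Banach space $X$. A set $W\subset\mathcal{F}(M)$ is tight if for every $\varepsilon>0$ there is a compact $K\subset M$ such that $W\subset\mathcal{F}(K)+\varepsilon B_{\mathcal{F}(M)}$. A sequence $(x_n)$ in a Banach space $X$ is weakly Cauchy if $(\langle x^*,x_n\rangle)_n$ converges for every $x^*\in X^*$. A subset $W$ of a Banach space is weakly precompact if every sequence in $W$ admits a weakly Cauchy subsequence.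 *)

theory Defs
  imports "HOL-Analysis.Analysis"
begin

text \<open>A pointed metric space is a type of sort \<open>{metric_space, zero}\<close>. The only role of the
  class \<open>zero\<close> is to supply the distinguished base point \<open>0\<close>; no algebraic
  law for it is assumed.\<close>

section \<open>The space of Lipschitz functions vanishing at the base point\<close>

typedef (overloaded) 'a lip0 =
  "{f :: 'a::{metric_space, zero} \<Rightarrow> real. f 0 = 0 \<and> (\<exists>C. C-lipschitz_on UNIV f)}"
  morphisms lip0_apply Lip0
  by (rule exI[of _ "\<lambda>_. 0"]) (auto intro: lipschitz_on_constant)

setup_lifting type_definition_lip0

lemma lip0_eqI: "(\<And>x. lip0_apply f x = lip0_apply g x) \<Longrightarrow> f = g"
  by transfer auto

lemma lip0_apply_base [simp]: "lip0_apply f 0 = 0"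
  by transfer auto

instantiation lip0 :: ("{metric_space, zero}") real_vector
begin

lift_definition zero_lip0 :: "'a lip0" is "\<lambda>_. 0"
  by (auto intro: lipschitz_on_constant)

lift_definition plus_lip0 :: "'a lip0 \<Rightarrow> 'a lip0 \<Rightarrow> 'a lip0" is "\<lambda>f g x. f x + g x"
  by (auto intro: lipschitz_on_add)

lift_definition minus_lip0 :: "'a lip0 \<Rightarrow> 'a lip0 \<Rightarrow> 'a lip0" is "\<lambda>f g x. f x - g x"
  by (auto intro: lipschitz_on_diff)

lift_definition uminus_lip0 :: "'a lip0 \<Rightarrow> 'a lip0" is "\<lambda>f x. - f x"
  by auto

lift_definition scaleR_lip0 :: "real \<Rightarrow> 'a lip0 \<Rightarrow> 'a lip0" is "\<lambda>c f x. c * f x"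
  by (auto intro: lipschitz_on_cmult_real)

instance
proof
  fix f g h :: "'a lip0" and a b :: real
  show "f + g + h = f + (g + h)" by (rule lip0_eqI) (simp add: plus_lip0.rep_eq)
  show "f + g = g + f" by (rule lip0_eqI) (simp add: plus_lip0.rep_eq)
  show "0 + f = f" by (rule lip0_eqI) (simp add: plus_lip0.rep_eq zero_lip0.rep_eq)
  show "- f + f = 0"
    by (rule lip0_eqI) (simp add: plus_lip0.rep_eq uminus_lip0.rep_eq zero_lip0.rep_eq)
  show "f - g = f + - g"
    by (rule lip0_eqI) (simp add: plus_lip0.rep_eq uminus_lip0.rep_eq minus_lip0.rep_eq)
  show "a *\<^sub>R (f + g) = a *\<^sub>R f + a *\<^sub>R g"
    by (rule lip0_eqI) (simp add: plus_lip0.rep_eq scaleR_lip0.rep_eq distrib_left)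
  show "(a + b) *\<^sub>R f = a *\<^sub>R f + b *\<^sub>R f"
    by (rule lip0_eqI) (simp add: plus_lip0.rep_eq scaleR_lip0.rep_eq distrib_right)
  show "a *\<^sub>R b *\<^sub>R f = (a * b) *\<^sub>R f"
    by (rule lip0_eqI) (simp add: scaleR_lip0.rep_eq)
  show "1 *\<^sub>R f = f" by (rule lip0_eqI) (simp add: scaleR_lip0.rep_eq)
qed

end

instantiation lip0 :: ("{metric_space, zero}") real_normed_vector
begin

lift_definition norm_lip0 :: "'a lip0 \<Rightarrow> real" is "\<lambda>f. Inf {C. C-lipschitz_on UNIV f}" .

definition dist_lip0 :: "'a lip0 \<Rightarrow> 'a lip0 \<Rightarrow> real"
  where "dist_lip0 f g = norm (f - g)"

definition sgn_lip0 :: "'a lip0 \<Rightarrow> 'a lip0"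
  where "sgn_lip0 f = f /\<^sub>R norm f"

definition uniformity_lip0 :: "('a lip0 \<times> 'a lip0) filter"
  where "uniformity_lip0 = (INF e\<in>{0 <..}. principal {(x, y). dist x y < e})"

definition open_lip0 :: "'a lip0 set \<Rightarrow> bool"
  where "open_lip0 S = (\<forall>x\<in>S. \<forall>\<^sub>F (x', y) in uniformity. x' = x \<longrightarrow> y \<in> S)"

lemma norm_lip0_le: "C-lipschitz_on UNIV (lip0_apply f) \<Longrightarrow> norm f \<le> C"
  unfolding norm_lip0.rep_eq
  by (rule cInf_lower) (auto intro!: bdd_belowI[of _ 0] simp: lipschitz_on_nonneg)

lemma lipschitz_on_norm_lip0: "(norm f)-lipschitz_on UNIV (lip0_apply f)"
proof -
  let ?S = "{C. C-lipschitz_on UNIV (lip0_apply f)}"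
  have ne: "?S \<noteq> {}"
    using lip0_apply[of f] by auto
  show ?thesis
    unfolding norm_lip0.rep_eq
  proof (rule lipschitz_onI)
    show "0 \<le> Inf ?S"
      using ne by (auto intro!: cInf_greatest simp: lipschitz_on_nonneg)
    fix x y :: 'a
    show "dist (lip0_apply f x) (lip0_apply f y) \<le> Inf ?S * dist x y"
    proof (cases "x = y")
      case False
      have "dist (lip0_apply f x) (lip0_apply f y) / dist x y \<le> Inf ?S"
        using ne False
        by (intro cInf_greatest) (auto simp: divide_simps dest: lipschitz_onD)
      then show ?thesis
        using False by (simp add: divide_simps)
    qed simp
  qed
qed

instance
proof
  fix f g :: "'a lip0" and a :: real
  have nonneg: "0 \<le> norm h" for h :: "'a lip0"
    using lipschitz_on_norm_lip0 by (rule lipschitz_on_nonneg)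
  show "norm f = 0 \<longleftrightarrow> f = 0"
  proof
    assume "norm f = 0"
    then have "0-lipschitz_on UNIV (lip0_apply f)"
      using lipschitz_on_norm_lip0[of f] by simp
    then have "lip0_apply f x = lip0_apply f 0" for x
      using lipschitz_onD[of 0 UNIV "lip0_apply f" x 0] by simp
    then show "f = 0"
      by (intro lip0_eqI) (simp add: zero_lip0.rep_eq)
  next
    assume "f = 0"
    then have "norm f \<le> 0"
      by (intro norm_lip0_le) (simp add: zero_lip0.rep_eq lipschitz_on_constant)
    with nonneg[of f] show "norm f = 0" by simp
  qed
  show "norm (f + g) \<le> norm f + norm g"
    by (rule norm_lip0_le)
      (simp add: plus_lip0.rep_eq lipschitz_on_add lipschitz_on_norm_lip0)
  have le: "norm (c *\<^sub>R h) \<le> \<bar>c\<bar> * norm h" for c and h :: "'a lip0"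
    by (rule norm_lip0_le)
      (simp add: scaleR_lip0.rep_eq lipschitz_on_cmult_real lipschitz_on_norm_lip0)
  show "norm (a *\<^sub>R f) = \<bar>a\<bar> * norm f"
  proof (cases "a = 0")
    case True
    with le[of a f] nonneg[of "a *\<^sub>R f"] show ?thesis by simp
  next
    case False
    have "norm f \<le> \<bar>inverse a\<bar> * norm (a *\<^sub>R f)"
      using le[of "inverse a" "a *\<^sub>R f"] False by simp
    with False have "\<bar>a\<bar> * norm f \<le> norm (a *\<^sub>R f)"
      by (simp add: field_simps)
    with le[of a f] show ?thesis by simp
  qed
qed (rule dist_lip0_def sgn_lip0_def uniformity_lip0_def open_lip0_def)+

end

lemma abs_lip0_apply_le: "\<bar>lip0_apply f x\<bar> \<le> norm f * dist x 0"
  using lipschitz_onD[OF lipschitz_on_norm_lip0[of f], of x 0] by (simp add: dist_real_def)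


section \<open>The Lipschitz-free space\<close>

lift_definition delta_dual :: "'a::{metric_space, zero} \<Rightarrow> ('a lip0 \<Rightarrow>\<^sub>L real)"
  is "\<lambda>x f. lip0_apply f x"
proof -
  fix x :: 'a
  show "bounded_linear (\<lambda>f. lip0_apply f x)"
    by (rule bounded_linear_intro[of _ "dist x 0"])
      (auto simp: plus_lip0.rep_eq scaleR_lip0.rep_eq abs_lip0_apply_le mult.commute)
qed

typedef (overloaded) 'a lip_free =
  "closure (span (range (delta_dual :: 'a::{metric_space, zero} \<Rightarrow> _)))"
  morphisms free_to_dual Free_of_dual
  using closure_subset span_zero by blast

setup_lifting type_definition_lip_free

lemma subspace_lip_free:
  "subspace (closure (span (range (delta_dual :: 'a::{metric_space, zero} \<Rightarrow> _))))"
proof (rule subspaceI)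
  let ?S = "span (range (delta_dual :: 'a \<Rightarrow> _))"
  show "0 \<in> closure ?S"
    using closure_subset span_zero by blast
  show "x + y \<in> closure ?S" if x: "x \<in> closure ?S" and y: "y \<in> closure ?S" for x y
  proof -
    obtain u where u: "\<forall>n. u n \<in> ?S" "u \<longlonglongrightarrow> x"
      using iffD1[OF closure_sequential x] by (elim exE conjE)
    obtain v where v: "\<forall>n. v n \<in> ?S" "v \<longlonglongrightarrow> y"
      using iffD1[OF closure_sequential y] by (elim exE conjE)
    have "\<forall>n. u n + v n \<in> ?S"
      using u(1) v(1) by (simp add: span_add)
    then show ?thesis
      using tendsto_add[OF u(2) v(2)]
      by (intro iffD2[OF closure_sequential] exI[of _ "\<lambda>n. u n + v n"] conjI)
  qed
  show "c *\<^sub>R x \<in> closure ?S" if x: "x \<in> closure ?S" for c x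
  proof -
    obtain u where u: "\<forall>n. u n \<in> ?S" "u \<longlonglongrightarrow> x"
      using iffD1[OF closure_sequential x] by (elim exE conjE)
    have "\<forall>n. c *\<^sub>R u n \<in> ?S"
      using u(1) by (simp add: span_scale)
    then show ?thesis
      using tendsto_scaleR[OF tendsto_const u(2)]
      by (intro iffD2[OF closure_sequential] exI[of _ "\<lambda>n. c *\<^sub>R u n"] conjI)
  qed
qed

instantiation lip_free :: ("{metric_space, zero}") real_vector
begin

lift_definition zero_lip_free :: "'a lip_free" is 0
  by (rule subspace_0[OF subspace_lip_free])

lift_definition plus_lip_free :: "'a lip_free \<Rightarrow> 'a lip_free \<Rightarrow> 'a lip_free" is "(+)"
  by (rule subspace_add[OF subspace_lip_free])

lift_definition minus_lip_free :: "'a lip_free \<Rightarrow> 'a lip_free \<Rightarrow> 'a lip_free" is "(-)"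
  by (rule subspace_diff[OF subspace_lip_free])

lift_definition uminus_lip_free :: "'a lip_free \<Rightarrow> 'a lip_free" is uminus
  by (rule subspace_neg[OF subspace_lip_free])

lift_definition scaleR_lip_free :: "real \<Rightarrow> 'a lip_free \<Rightarrow> 'a lip_free" is "(*\<^sub>R)"
  by (rule subspace_scale[OF subspace_lip_free])

instance
proof
  fix \<mu> \<nu> \<rho> :: "'a lip_free" and a b :: real
  show "\<mu> + \<nu> + \<rho> = \<mu> + (\<nu> + \<rho>)" by transfer (rule add.assoc)
  show "\<mu> + \<nu> = \<nu> + \<mu>" by transfer (rule add.commute)
  show "0 + \<mu> = \<mu>" by transfer simp
  show "- \<mu> + \<mu> = 0" by transfer simp
  show "\<mu> - \<nu> = \<mu> + - \<nu>" by transfer simp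
  show "a *\<^sub>R (\<mu> + \<nu>) = a *\<^sub>R \<mu> + a *\<^sub>R \<nu>" by transfer (rule scaleR_add_right)
  show "(a + b) *\<^sub>R \<mu> = a *\<^sub>R \<mu> + b *\<^sub>R \<mu>" by transfer (rule scaleR_add_left)
  show "a *\<^sub>R b *\<^sub>R \<mu> = (a * b) *\<^sub>R \<mu>" by transfer simp
  show "1 *\<^sub>R \<mu> = \<mu>" by transfer simp
qed

end

instantiation lip_free :: ("{metric_space, zero}") real_normed_vector
begin

lift_definition norm_lip_free :: "'a lip_free \<Rightarrow> real" is norm .

definition dist_lip_free :: "'a lip_free \<Rightarrow> 'a lip_free \<Rightarrow> real"
  where "dist_lip_free \<mu> \<nu> = norm (\<mu> - \<nu>)"

definition sgn_lip_free :: "'a lip_free \<Rightarrow> 'a lip_free"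
  where "sgn_lip_free \<mu> = \<mu> /\<^sub>R norm \<mu>"

definition uniformity_lip_free :: "('a lip_free \<times> 'a lip_free) filter"
  where "uniformity_lip_free = (INF e\<in>{0 <..}. principal {(x, y). dist x y < e})"

definition open_lip_free :: "'a lip_free set \<Rightarrow> bool"
  where "open_lip_free S = (\<forall>x\<in>S. \<forall>\<^sub>F (x', y) in uniformity. x' = x \<longrightarrow> y \<in> S)"

instance
proof
  fix \<mu> \<nu> :: "'a lip_free" and a :: real
  show "norm \<mu> = 0 \<longleftrightarrow> \<mu> = 0" by transfer simp
  show "norm (\<mu> + \<nu>) \<le> norm \<mu> + norm \<nu>" by transfer (rule norm_triangle_ineq)
  show "norm (a *\<^sub>R \<mu>) = \<bar>a\<bar> * norm \<mu>" by transfer simp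
qed (rule dist_lip_free_def sgn_lip_free_def uniformity_lip_free_def open_lip_free_def)+

end

lemma dist_free_to_dual: "dist (free_to_dual \<mu>) (free_to_dual \<nu>) = dist \<mu> \<nu>"
  by (simp add: dist_norm minus_lip_free.rep_eq norm_lip_free.rep_eq)

instance lip_free :: ("{metric_space, zero}") banach
proof
  fix X :: "nat \<Rightarrow> 'a lip_free"
  assume "Cauchy X"
  then have "Cauchy (\<lambda>n. free_to_dual (X n))"
    by (simp add: Cauchy_def dist_free_to_dual)
  then obtain l where l: "(\<lambda>n. free_to_dual (X n)) \<longlonglongrightarrow> l"
    by (auto simp: Cauchy_convergent_iff convergent_def)
  have "l \<in> closure (span (range (delta_dual :: 'a \<Rightarrow> _)))"
    by (rule closed_sequentially[OF closed_closure free_to_dual l])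
  then obtain \<mu> :: "'a lip_free" where "l = free_to_dual \<mu>"
    by (rule free_to_dual_cases)
  with l have "X \<longlonglongrightarrow> \<mu>"
    by (simp add: lim_sequentially dist_free_to_dual)
  then show "convergent X"
    by (auto simp: convergent_def)
qed

lift_definition delta :: "'a::{metric_space, zero} \<Rightarrow> 'a lip_free" is delta_dual
  by (rule subsetD[OF closure_subset]) (simp add: span_base)

lemma delta_base [simp]: "delta 0 = 0"
  by transfer (rule blinfun_eqI, simp add: delta_dual.rep_eq)

text \<open>\<open>\<F>(N)\<close> as a closed subspace of \<open>\<F>(M)\<close>, for an arbitrary
  subset \<open>N\<close> of \<open>M\<close>. Since \<open>delta 0 = 0\<close>, it is immaterial
  whether \<open>N\<close> contains the base point.\<close>

definition free_over :: "'a::{metric_space, zero} set \<Rightarrow> 'a lip_free set"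
  where "free_over N = closure (span (delta ` N))"

definition tight :: "'a::{metric_space, zero} lip_free set \<Rightarrow> bool"
  where "tight W \<longleftrightarrow>
    (\<forall>\<epsilon>>0. \<exists>K. compact K \<and> W \<subseteq> {\<nu> + \<epsilon> *\<^sub>R \<beta> | \<nu> \<beta>. \<nu> \<in> free_over K \<and> \<beta> \<in> cball 0 1})"


section \<open>Weak precompactness\<close>

definition weakly_Cauchy :: "(nat \<Rightarrow> 'b::banach) \<Rightarrow> bool"
  where "weakly_Cauchy x \<longleftrightarrow> (\<forall>\<phi> :: 'b \<Rightarrow>\<^sub>L real. convergent (\<lambda>n. blinfun_apply \<phi> (x n)))"

definition weakly_precompact :: "'b::banach set \<Rightarrow> bool"
  where "weakly_precompact W \<longleftrightarrow>
    (\<forall>x :: nat \<Rightarrow> 'b. range x \<subseteq> W \<longrightarrow> (\<exists>r. strict_mono r \<and> weakly_Cauchy (x \<circ> r)))"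


text \<open>Linearity of a map that is only relevant on the linear subspace \<open>S\<close>; its values
  outside \<open>S\<close> are arbitrary.\<close>

definition linear_on_subspace ::
    "'b::real_vector set \<Rightarrow> ('b \<Rightarrow> 'c::real_vector) \<Rightarrow> bool"
  where "linear_on_subspace S T \<longleftrightarrow>
    (\<forall>x\<in>S. \<forall>y\<in>S. T (x + y) = T x + T y) \<and> (\<forall>c. \<forall>x\<in>S. T (c *\<^sub>R x) = c *\<^sub>R T x)"

end

theory Submission
  imports Defs
begin

text \<open>Multiplication by a function \<open>h\<close> with \<open>\<bar>h\<bar> \<le> 1\<close> whose oscillation between
  \<open>x\<close> and \<open>y\<close> is at most \<open>L * dist x y / dist x 0\<close> acts on the Lipschitz functions with norm
  at most \<open>L + 1\<close> and has a preadjoint on the free space. For a finite set \<open>E\<close> there is such an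
  \<open>h\<close> that is \<open>1\<close> where \<open>infdist x E \<le> \<delta> * (1 + dist x 0)\<close> and vanishes where
  \<open>infdist x E > 2 * \<delta> * (1 + dist x 0)\<close>, and its \<open>L\<close> depends on \<open>\<delta>\<close> only. Scaling
  the neighbourhoods by \<open>1 + dist x 0\<close> treats bounded and unbounded spaces alike.

  If, for some \<open>\<delta>\<close>, no such neighbourhood of a finite set carries the elements of \<open>W\<close> up to
  \<open>\<epsilon>\<close>, one finds a bounded sequence of disjointly supported Lipschitz functions on which elements
  of \<open>W\<close> are bounded away from zero, and a gliding hump contradicts weak precompactness. So there are
  finite sets \<open>E k\<close> for \<open>\<delta> k = (1 / 2) ^ k\<close> with errors as small as we like, and the products of
  the first \<open>k\<close> cutoffs give operators that converge uniformly on \<open>W\<close>. The intersection \<open>K\<close> of the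
  supports is compact, and the limit lies in \<open>\<F>(K)\<close> by Hahn--Banach: a Lipschitz function vanishing
  on \<open>K\<close> is small on the support of a late product.\<close>

section \<open>Hahn--Banach\<close>

text \<open>Homogeneity is asked as an inequality only: for \<open>c > 0\<close>, applying it with
  \<open>inverse c\<close> as well turns it into an equality, and \<open>c = 0\<close> yields
  \<open>q 0 \<le> 0\<close>.\<close>

definition sublinear :: "('b::real_vector \<Rightarrow> real) \<Rightarrow> bool"
  where "sublinear q \<longleftrightarrow>
    (\<forall>u v. q (u + v) \<le> q u + q v) \<and> (\<forall>c v. 0 \<le> c \<longrightarrow> q (c *\<^sub>R v) \<le> c * q v)"

lemma sublinearI:
  assumes "\<And>u v. q (u + v) \<le> q u + q v" "\<And>c v. 0 < c \<Longrightarrow> q (c *\<^sub>R v) \<le> c * q v" "q 0 \<le> 0"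
  shows "sublinear q"
proof -
  have "q (c *\<^sub>R v) \<le> c * q v" if "0 \<le> c" for c v
    using assms(2)[of c v] assms(3) that by (cases "c = 0") auto
  with assms(1) show ?thesis by (simp add: sublinear_def)
qed

lemma sublinear_add: "sublinear q \<Longrightarrow> q (u + v) \<le> q u + q v"
  and sublinear_scale: "sublinear q \<Longrightarrow> 0 \<le> c \<Longrightarrow> q (c *\<^sub>R v) \<le> c * q v"
  by (auto simp: sublinear_def)

lemma sublinear_zero: "sublinear q \<Longrightarrow> q 0 = 0"
  using sublinear_add[of q 0 0] sublinear_scale[of q 0 0] by simp

lemma sublinear_minus: "sublinear q \<Longrightarrow> - q (- v) \<le> q v"
  using sublinear_add[of q v "- v"] sublinear_zero[of q] by simp

text \<open>The infimum of \<open>q (v + t *\<^sub>R y) - t * q y\<close> over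
  \<open>t \<ge> 0\<close> is again sublinear; \<open>t = 0\<close> puts it below \<open>q\<close>,
  and \<open>t = 1\<close> gives the bound at \<open>- y\<close>. Any linear functional below it
  takes at \<open>y\<close> a value of at least \<open>q y\<close>.\<close>

lemma sublinear_tilt:
  fixes q :: "'b::real_vector \<Rightarrow> real"
  assumes q: "sublinear q"
  obtains r where "sublinear r" "\<And>v. r v \<le> q v" "r (- y) \<le> - q y"
proof -
  define F where "F v t = q (v + t *\<^sub>R y) - t * q y" for v t
  define r where "r v = (INF t\<in>{0..}. F v t)" for v
  \<comment> \<open>This bound, independent of \<open>t\<close>, makes the infimum finite.\<close>
  have lower: "- q (- v) \<le> F v t" if t: "0 \<le> t" for v t
  proof -
    have "t * q y \<le> q (t *\<^sub>R y)"
    proof (cases "t = 0")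
      case False
      with t sublinear_scale[OF q, of "inverse t" "t *\<^sub>R y"] show ?thesis
        by (simp add: field_simps)
    qed (simp add: sublinear_zero[OF q])
    also have "\<dots> \<le> q (v + t *\<^sub>R y) + q (- v)"
      using sublinear_add[OF q, of "v + t *\<^sub>R y" "- v"] by simp
    finally show ?thesis by (simp add: F_def)
  qed
  have le: "r v \<le> F v t" if "0 \<le> t" for v t
    unfolding r_def using lower that by (intro cINF_lower) (auto intro!: bdd_belowI2)
  have ge: "m \<le> r v" if "\<And>t. 0 \<le> t \<Longrightarrow> m \<le> F v t" for m v
    unfolding r_def using that by (intro cINF_greatest) auto
  show thesis
  proof
    show "r v \<le> q v" for v
      using le[of 0 v] by (simp add: F_def)
    show "r (- y) \<le> - q y"
      using le[of 1 "- y"] by (simp add: F_def sublinear_zero[OF q])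
    show "sublinear r"
    proof (rule sublinearI)
      fix u v :: 'b and c :: real
      have "r (u + v) \<le> F u s + F v t" if "0 \<le> s" "0 \<le> t" for s t
      proof -
        have "r (u + v) \<le> F (u + v) (s + t)"
          using that by (intro le) simp
        also have "\<dots> \<le> F u s + F v t"
          using sublinear_add[OF q, of "u + s *\<^sub>R y" "v + t *\<^sub>R y"]
          by (simp add: F_def algebra_simps)
        finally show ?thesis .
      qed
      then have "r (u + v) - F v t \<le> r u" if "0 \<le> t" for t
        using that by (intro ge) (simp add: algebra_simps)
      then have "r (u + v) - r u \<le> r v"
        by (intro ge) (simp add: algebra_simps)
      then show "r (u + v) \<le> r u + r v" by simp
      show "r (c *\<^sub>R v) \<le> c * r v" if c: "0 < c"
      proof -
        have "r (c *\<^sub>R v) / c \<le> F v t" if t: "0 \<le> t" for t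
        proof -
          have "r (c *\<^sub>R v) \<le> F (c *\<^sub>R v) (c * t)"
            using c t by (intro le) simp
          also have "\<dots> \<le> c * F v t"
            using sublinear_scale[OF q, of c "v + t *\<^sub>R y"] c by (simp add: F_def algebra_simps)
          finally show ?thesis using c by (simp add: field_simps)
        qed
        then have "r (c *\<^sub>R v) / c \<le> r v" by (rule ge)
        then show ?thesis using c by (simp add: field_simps)
      qed
      show "r 0 \<le> 0" using le[of 0 0] by (simp add: F_def sublinear_zero[OF q])
    qed
  qed
qed

text \<open>By minimality the tilt of \<open>q\<close> at any \<open>y\<close> is \<open>q\<close>
  itself, so \<open>q (- y) \<le> - q y\<close>. Hence \<open>q\<close> is odd, and an odd sublinear
  functional is linear.\<close>

lemma minimal_sublinear_linear:
  fixes q :: "'b::real_vector \<Rightarrow> real"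
  assumes q: "sublinear q" and min: "\<And>r. sublinear r \<Longrightarrow> (\<And>v. r v \<le> q v) \<Longrightarrow> r = q"
  shows "linear q"
proof -
  have neg: "q (- y) = - q y" for y
  proof -
    obtain r where "sublinear r" "\<And>v. r v \<le> q v" "r (- y) \<le> - q y"
      using sublinear_tilt[OF q, of y] by blast
    with min[of r] sublinear_minus[OF q, of y] show ?thesis by simp
  qed
  have pos: "q (c *\<^sub>R v) = c * q v" if "0 \<le> c" for c v
    using sublinear_scale[OF q that, of v] sublinear_scale[OF q that, of "- v"]
    by (simp add: neg)
  show ?thesis
  proof (rule linearI)
    show "q (u + v) = q u + q v" for u v
      using sublinear_add[OF q, of u v] sublinear_add[OF q, of "u + v" "- v"] by (simp add: neg)
    show "q (c *\<^sub>R v) = c *\<^sub>R q v" for c v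
      using pos[of c v] pos[of "- c" v] neg[of "c *\<^sub>R v"] by (cases "0 \<le> c") auto
  qed
qed

text \<open>A minimal sublinear functional below \<open>p\<close> is linear; this spares the usual extension of
  functionals along a chain of subspaces.\<close>

lemma exists_linear_below_sublinear:
  fixes p :: "'b::real_vector \<Rightarrow> real"
  assumes p: "sublinear p"
  obtains \<phi> where "linear \<phi>" "\<And>v. \<phi> v \<le> p v"
proof -
  define A where "A = {q. sublinear q \<and> (\<forall>v. q v \<le> p v)}"
  \<comment> \<open>The order is reversed: the maximal element supplied by Zorn's lemma is a
    pointwise minimal functional.\<close>
  define P :: "('b \<Rightarrow> real) \<Rightarrow> ('b \<Rightarrow> real) \<Rightarrow> bool" where "P q r \<longleftrightarrow> (\<forall>v. r v \<le> q v)" for q r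
  have "\<exists>m\<in>A. \<forall>a\<in>A. P m a \<longrightarrow> a = m"
  proof (rule predicate_Zorn)
    show "partial_order_on A (relation_of P A)"
      by (rule partial_order_on_relation_ofI) (auto simp: P_def fun_eq_iff intro: order.trans antisym)
    fix C assume C: "C \<in> Chains (relation_of P A)"
    show "\<exists>u\<in>A. \<forall>a\<in>C. P a u"
    proof (cases "C = {}")
      case True
      with p show ?thesis by (auto simp: A_def)
    next
      case False
      have CA: "q \<in> A" if "q \<in> C" for q
        using C that by (auto simp: Chains_def relation_of_def)
      have total: "P q r \<or> P r q" if "q \<in> C" "r \<in> C" for q r
        using C that by (auto simp: Chains_def relation_of_def)
      define u where "u v = (INF q\<in>C. q v)" for v
      \<comment> \<open>All members of the chain share the lower bound \<open>- p (- v)\<close>, so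
        their pointwise infimum is finite.\<close>
      have lower: "- p (- v) \<le> q v" if "q \<in> C" for q v
        using CA[OF that] sublinear_minus[of q v] by (auto simp: A_def intro: order_trans[rotated])
      have le: "u v \<le> q v" if "q \<in> C" for q v
        unfolding u_def using lower that by (intro cINF_lower) (auto intro!: bdd_belowI2)
      have ge: "m \<le> u v" if "\<And>q. q \<in> C \<Longrightarrow> m \<le> q v" for m v
        unfolding u_def using that False by (intro cINF_greatest) auto
      have "sublinear u"
      proof (rule sublinearI)
        fix v w :: 'b and c :: real
        have "u (v + w) \<le> q v + r w" if qr: "q \<in> C" "r \<in> C" for q r
        proof -
          obtain s where s: "s \<in> C" "\<forall>v. s v \<le> q v" "\<forall>v. s v \<le> r v"
            using total[OF qr] qr unfolding P_def by blast
          have "u (v + w) \<le> s (v + w)" using s(1) by (rule le)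
          also have "\<dots> \<le> s v + s w" using CA[OF s(1)] by (intro sublinear_add) (simp add: A_def)
          also have "\<dots> \<le> q v + r w" using s by (intro add_mono) auto
          finally show ?thesis .
        qed
        then have "u (v + w) - r w \<le> u v" if "r \<in> C" for r
          using that by (intro ge) (simp add: algebra_simps)
        then have "u (v + w) - u v \<le> u w"
          by (intro ge) (simp add: algebra_simps)
        then show "u (v + w) \<le> u v + u w" by simp
        show "u (c *\<^sub>R v) \<le> c * u v" if c: "0 < c"
        proof -
          have "u (c *\<^sub>R v) / c \<le> q v" if "q \<in> C" for q
            using le[OF that, of "c *\<^sub>R v"] sublinear_scale[of q c v] CA[OF that] c
            by (simp add: A_def field_simps)
          then have "u (c *\<^sub>R v) / c \<le> u v" by (rule ge)
          then show ?thesis using c by (simp add: field_simps)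
        qed
        obtain q where "q \<in> C" using False by blast
        then show "u 0 \<le> 0" using le[of q 0] CA[of q] sublinear_zero[of q] by (simp add: A_def)
      qed
      moreover have "u v \<le> p v" for v
      proof -
        obtain q where "q \<in> C" using False by blast
        with le[of q v] CA[of q] show ?thesis by (auto simp: A_def intro: order_trans)
      qed
      ultimately have "u \<in> A" by (simp add: A_def)
      then show ?thesis using le by (auto simp: P_def)
    qed
  qed
  then obtain m where m: "m \<in> A" "\<And>a. a \<in> A \<Longrightarrow> P m a \<Longrightarrow> a = m" by blast
  have "linear m"
  proof (rule minimal_sublinear_linear)
    show "sublinear m" using m(1) by (simp add: A_def)
    fix r assume r: "sublinear r" "\<And>v. r v \<le> m v"
    have "r v \<le> p v" for v
      using r(2)[of v] m(1) by (auto simp: A_def intro: order_trans)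
    with r show "r = m" by (intro m(2)) (auto simp: A_def P_def)
  qed
  with m(1) show thesis by (intro that) (auto simp: A_def)
qed

text \<open>The distance to a subspace is the quotient seminorm.\<close>

lemma sublinear_infdist:
  fixes S :: "'b::real_normed_vector set"
  assumes S: "subspace S"
  shows "sublinear (\<lambda>v. infdist v S)"
proof (rule sublinearI)
  have ne: "S \<noteq> {}" using subspace_0[OF S] by blast
  have le: "infdist v S \<le> norm (v - s)" if "s \<in> S" for v s
    using infdist_le[OF that, of v] by (simp add: dist_norm)
  have ge: "m \<le> infdist v S" if "\<And>s. s \<in> S \<Longrightarrow> m \<le> norm (v - s)" for m v
    using that ne by (auto simp: infdist_def dist_norm intro!: cINF_greatest)
  fix u v :: 'b and c :: real
  have "infdist (u + v) S \<le> norm (u - s) + norm (v - t)" if "s \<in> S" "t \<in> S" for s t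
    using le[OF subspace_add[OF S that], of "u + v"] norm_triangle_ineq[of "u - s" "v - t"]
    by (simp add: algebra_simps)
  then have "infdist (u + v) S - norm (v - t) \<le> infdist u S" if "t \<in> S" for t
    using that by (intro ge) (simp add: algebra_simps)
  then have "infdist (u + v) S - infdist u S \<le> infdist v S"
    by (intro ge) (simp add: algebra_simps)
  then show "infdist (u + v) S \<le> infdist u S + infdist v S" by simp
  show "infdist (c *\<^sub>R v) S \<le> c * infdist v S" if c: "0 < c"
  proof -
    have "infdist (c *\<^sub>R v) S / c \<le> norm (v - s)" if "s \<in> S" for s
    proof -
      have "infdist (c *\<^sub>R v) S \<le> norm (c *\<^sub>R (v - s))"
        using le[OF subspace_scale[OF S that, of c], of "c *\<^sub>R v"] by (simp add: scaleR_diff_right)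
      with c show ?thesis by (simp add: divide_le_eq mult.commute)
    qed
    then have "infdist (c *\<^sub>R v) S / c \<le> infdist v S" by (rule ge)
    then show ?thesis using c by (simp add: field_simps)
  qed
  show "infdist 0 S \<le> 0" using infdist_zero[OF subspace_0[OF S]] by simp
qed

text \<open>A linear functional dominated by the distance to \<open>S\<close> vanishes on
  \<open>S\<close> and has norm at most 1. Tilting the distance at \<open>x\<close> beforehand
  forces the value at \<open>x\<close> to be at least \<open>infdist x S\<close>, which is
  positive.\<close>

lemma exists_functional_vanishing_on_subspace:
  fixes S :: "'b::real_normed_vector set"
  assumes S: "subspace S" and x: "x \<notin> closure S"
  obtains \<phi> :: "'b \<Rightarrow>\<^sub>L real" where "\<And>s. s \<in> S \<Longrightarrow> \<phi> s = 0" "\<phi> x \<noteq> 0"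
proof -
  have ne: "S \<noteq> {}" using subspace_0[OF S] by blast
  obtain q where q: "sublinear q" "\<And>v. q v \<le> infdist v S" "q (- x) \<le> - infdist x S"
    using sublinear_tilt[OF sublinear_infdist[OF S], of x] by blast
  obtain \<phi> where \<phi>: "linear \<phi>" "\<And>v. \<phi> v \<le> q v"
    using exists_linear_below_sublinear[OF q(1)] by blast
  have le: "\<phi> v \<le> infdist v S" for v
    using \<phi>(2) q(2) by (rule order_trans)
  have abs: "\<bar>\<phi> v\<bar> \<le> infdist v S" for v
  proof -
    have "infdist (- v) S \<le> infdist v S"
    proof -
      have "infdist (- v) S \<le> norm (v - s)" if "s \<in> S" for s
        using infdist_le[OF subspace_neg[OF S that], of "- v"]
        by (simp add: dist_norm norm_minus_commute)
      then show ?thesis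
        using ne by (auto simp: infdist_def[of v] dist_norm intro!: cINF_greatest)
    qed
    with le[of v] le[of "- v"] linear_neg[OF \<phi>(1), of v] show ?thesis by auto
  qed
  have "infdist v S \<le> norm v" for v
    using infdist_le[OF subspace_0[OF S], of v] by simp
  with abs have "bounded_linear \<phi>"
    using \<phi>(1) by (intro bounded_linear.intro bounded_linear_axioms.intro exI[of _ 1])
      (auto intro: order_trans)
  then have app: "blinfun_apply (Blinfun \<phi>) = \<phi>" by (rule bounded_linear_Blinfun_apply)
  show thesis
  proof (rule that[of "Blinfun \<phi>"])
    show "Blinfun \<phi> s = 0" if "s \<in> S" for s
      using abs[of s] that by (simp add: app)
    have "0 < infdist x S"
      using x ne in_closure_iff_infdist_zero[OF ne, of x] infdist_nonneg[of x S] by linarith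
    moreover have "- \<phi> x \<le> - infdist x S"
      using \<phi>(2)[of "- x"] q(3) linear_neg[OF \<phi>(1), of x] by simp
    ultimately show "Blinfun \<phi> x \<noteq> 0" by (simp add: app)
  qed
qed

section \<open>The duality between the free space and the Lipschitz functions\<close>

definition pairing :: "'a::{metric_space, zero} lip_free \<Rightarrow> 'a lip0 \<Rightarrow> real"
  where "pairing \<mu> f = blinfun_apply (free_to_dual \<mu>) f"

lemma pairing_simps:
  "pairing (\<mu> + \<nu>) f = pairing \<mu> f + pairing \<nu> f"
  "pairing (\<mu> - \<nu>) f = pairing \<mu> f - pairing \<nu> f"
  "pairing (c *\<^sub>R \<mu>) f = c * pairing \<mu> f"
  "pairing 0 f = 0"
  "pairing \<mu> (f + g) = pairing \<mu> f + pairing \<mu> g"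
  "pairing \<mu> (f - g) = pairing \<mu> f - pairing \<mu> g"
  "pairing \<mu> (c *\<^sub>R f) = c * pairing \<mu> f"
  "pairing \<mu> 0 = 0"
  "pairing (delta x) f = lip0_apply f x"
  by (simp_all add: pairing_def plus_lip_free.rep_eq minus_lip_free.rep_eq scaleR_lip_free.rep_eq
      zero_lip_free.rep_eq delta.rep_eq delta_dual.rep_eq blinfun.bilinear_simps)

lemma abs_pairing_le: "\<bar>pairing \<mu> f\<bar> \<le> norm \<mu> * norm f"
  using norm_blinfun[of "free_to_dual \<mu>" f] by (simp add: pairing_def norm_lip_free.rep_eq)

lemma norm_lip_free_le:
  assumes "0 \<le> B" "\<And>f. \<bar>pairing \<mu> f\<bar> \<le> B * norm f"
  shows "norm \<mu> \<le> B"
  unfolding norm_lip_free.rep_eq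
  using assms by (intro norm_blinfun_bound) (auto simp: pairing_def)

lemma bounded_linear_pairing: "bounded_linear (\<lambda>\<mu>. pairing \<mu> f)"
  by (rule bounded_linear_intro[of _ "norm f"])
    (auto simp: pairing_simps abs_pairing_le)

lemma tendsto_pairing: "(X \<longlongrightarrow> \<mu>) F \<Longrightarrow> ((\<lambda>n. pairing (X n) f) \<longlongrightarrow> pairing \<mu> f) F"
  by (rule bounded_linear.tendsto[OF bounded_linear_pairing])

lemma lip_free_eqI: "(\<And>f. pairing \<mu> f = pairing \<nu> f) \<Longrightarrow> \<mu> = \<nu>"
  unfolding pairing_def by (intro iffD1[OF free_to_dual_inject] blinfun_eqI)

lemma weakly_Cauchy_pairing:
  assumes "weakly_Cauchy \<mu>" shows "convergent (\<lambda>n. pairing (\<mu> n) f)"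
proof -
  have "convergent (\<lambda>n. blinfun_apply (Blinfun (\<lambda>\<mu>. pairing \<mu> f)) (\<mu> n))"
    using assms unfolding weakly_Cauchy_def by blast
  then show ?thesis by (simp add: bounded_linear_Blinfun_apply[OF bounded_linear_pairing])
qed

text \<open>The free space is by construction a closure inside the dual of the Lipschitz functions;
  density is pulled back along the linear isometry \<open>free_to_dual\<close>.\<close>

lemma closure_span_delta: "closure (span (range (delta :: 'a::{metric_space, zero} \<Rightarrow> _))) = UNIV"
proof -
  have lin: "linear (free_to_dual :: 'a lip_free \<Rightarrow> _)"
    by (rule linearI) (simp_all add: plus_lip_free.rep_eq scaleR_lip_free.rep_eq)
  have "free_to_dual ` span (range (delta :: 'a \<Rightarrow> _)) = span (range delta_dual)"
    by (simp add: linear_span_image[OF lin, symmetric] image_image delta.rep_eq)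
  then have img: "v \<in> free_to_dual ` span (range (delta :: 'a \<Rightarrow> _))"
    if "v \<in> span (range delta_dual)" for v using that by simp
  have "\<mu> \<in> closure (span (range delta))" for \<mu> :: "'a lip_free"
  proof (subst closure_approachable, intro allI impI)
    fix e :: real assume "0 < e"
    then obtain v where v: "v \<in> span (range delta_dual)" "dist v (free_to_dual \<mu>) < e"
      using free_to_dual[of \<mu>] unfolding closure_approachable by blast
    from img[OF v(1)] obtain \<nu> where "\<nu> \<in> span (range delta)" "v = free_to_dual \<nu>" by blast
    with v(2) show "\<exists>\<nu>\<in>span (range delta). dist \<nu> \<mu> < e"
      by (auto simp: dist_free_to_dual)
  qed
  then show ?thesis by blast
qed

lemma norm_delta_diff_le: "norm (delta x - delta y) \<le> dist x y"
proof (rule norm_lip_free_le)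
  fix f :: "'a lip0"
  show "\<bar>pairing (delta x - delta y) f\<bar> \<le> dist x y * norm f"
    using lipschitz_onD[OF lipschitz_on_norm_lip0[of f], of x y]
    by (simp add: pairing_simps dist_real_def mult.commute)
qed simp

text \<open>The dual of the free space is the space of Lipschitz functions: \<open>f\<close> is
  \<open>\<phi>\<close> composed with \<open>delta\<close>, which is Lipschitz because
  \<open>delta\<close> does not increase distances. Both sides agree on the span of the point
  evaluations, hence everywhere by density.\<close>

lemma functional_eq_pairing:
  fixes \<phi> :: "'a::{metric_space, zero} lip_free \<Rightarrow>\<^sub>L real"
  obtains f where "\<And>\<mu>. \<phi> \<mu> = pairing \<mu> f"
proof -
  have lip: "(norm \<phi>)-lipschitz_on UNIV (\<lambda>x. \<phi> (delta x))"
  proof (rule lipschitz_onI)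
    fix x y :: 'a
    have "dist (\<phi> (delta x)) (\<phi> (delta y)) \<le> norm \<phi> * norm (delta x - delta y)"
      using norm_blinfun[of \<phi> "delta x - delta y"] by (simp add: dist_norm blinfun.diff_right)
    also have "\<dots> \<le> norm \<phi> * dist x y"
      by (intro mult_left_mono norm_delta_diff_le) simp
    finally show "dist (\<phi> (delta x)) (\<phi> (delta y)) \<le> norm \<phi> * dist x y" .
  qed simp
  define f where "f = Lip0 (\<lambda>x. \<phi> (delta x))"
  have f: "lip0_apply f x = \<phi> (delta x)" for x
    unfolding f_def using lip by (subst Lip0_inverse) auto
  have cl: "closed {\<mu>. \<phi> \<mu> = pairing \<mu> f}"
    by (intro closed_Collect_eq continuous_intros
        bounded_linear.continuous_on[OF bounded_linear_pairing])
  have "\<phi> \<mu> = pairing \<mu> f" if "\<mu> \<in> span (range delta)" for \<mu>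
    using that
    by (induction rule: span_induct_alt) (auto simp: pairing_simps f blinfun.bilinear_simps)
  then have "closure (span (range delta)) \<subseteq> {\<mu>. \<phi> \<mu> = pairing \<mu> f}"
    using cl by (intro closure_minimal) auto
  then show thesis using that[of f] unfolding closure_span_delta by blast
qed

text \<open>An element outside the closed subspace is separated from it by a functional, and that
  functional is a Lipschitz function vanishing on \<open>N\<close>.\<close>

lemma mem_free_overI:
  assumes "\<And>f. (\<And>x. x \<in> N \<Longrightarrow> lip0_apply f x = 0) \<Longrightarrow> pairing \<mu> f = 0"
  shows "\<mu> \<in> free_over N"
proof (rule ccontr)
  assume "\<mu> \<notin> free_over N"
  then obtain \<phi> :: "'a lip_free \<Rightarrow>\<^sub>L real"
    where \<phi>: "\<And>s. s \<in> span (delta ` N) \<Longrightarrow> \<phi> s = 0" "\<phi> \<mu> \<noteq> 0"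
    unfolding free_over_def
    using exists_functional_vanishing_on_subspace[OF subspace_span] by blast
  obtain f where f: "\<And>\<mu>. \<phi> \<mu> = pairing \<mu> f"
    using functional_eq_pairing[of \<phi>] by blast
  have "lip0_apply f x = 0" if "x \<in> N" for x
    using \<phi>(1)[of "delta x"] f[of "delta x"] that by (simp add: pairing_simps span_base)
  with assms \<phi>(2) f show False by simp
qed

text \<open>Up to \<open>\<eta>\<close> in norm, \<open>\<mu>\<close> is a finite combination of
  point evaluations. \<open>E\<close> is the set of its points and \<open>C\<close> the sum of the
  absolute values of its coefficients.\<close>

lemma pairing_approx:
  fixes \<mu> :: "'a::{metric_space, zero} lip_free"
  assumes "0 < \<eta>"
  obtains E C where "finite E" "0 \<le> C"
    "\<And>g s. 0 \<le> s \<Longrightarrow> (\<And>x. x \<in> E \<Longrightarrow> \<bar>lip0_apply g x\<bar> \<le> s) \<Longrightarrow>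
      \<bar>pairing \<mu> g\<bar> \<le> \<eta> * norm g + C * s"
proof -
  obtain \<nu> where \<nu>: "\<nu> \<in> span (range (delta :: 'a \<Rightarrow> _))" "dist \<nu> \<mu> < \<eta>"
    using assms closure_span_delta unfolding closure_approachable set_eq_iff by blast
  have "\<exists>E C. finite E \<and> 0 \<le> C \<and> (\<forall>g s. 0 \<le> s \<longrightarrow> (\<forall>x\<in>E. \<bar>lip0_apply g x\<bar> \<le> s) \<longrightarrow>
      \<bar>pairing \<nu> g\<bar> \<le> C * s)"
    using \<nu>(1)
  proof (induction rule: span_induct_alt)
    case base
    show ?case by (intro exI[of _ "{}"] exI[of _ 0]) (simp add: pairing_simps)
  next
    case (step c \<delta> \<nu>)
    then obtain E C where E: "finite E" "0 \<le> C"
      "\<And>g s. 0 \<le> s \<Longrightarrow> \<forall>x\<in>E. \<bar>lip0_apply g x\<bar> \<le> s \<Longrightarrow> \<bar>pairing \<nu> g\<bar> \<le> C * s" by blast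
    from step obtain y where y: "\<delta> = delta y" by blast
    have "\<bar>pairing (c *\<^sub>R \<delta> + \<nu>) g\<bar> \<le> (\<bar>c\<bar> + C) * s"
      if "0 \<le> s" "\<forall>x\<in>insert y E. \<bar>lip0_apply g x\<bar> \<le> s" for g s
    proof -
      have "\<bar>c * lip0_apply g y\<bar> \<le> \<bar>c\<bar> * s"
        using that by (auto simp: abs_mult intro: mult_left_mono)
      moreover have "\<bar>pairing \<nu> g\<bar> \<le> C * s" using that by (intro E(3)) auto
      ultimately show ?thesis by (auto simp: y pairing_simps distrib_right)
    qed
    with E(1,2) show ?case by (intro exI[of _ "insert y E"] exI[of _ "\<bar>c\<bar> + C"]) auto
  qed
  then obtain E C where E: "finite E" "0 \<le> C"
      "\<And>g s. 0 \<le> s \<Longrightarrow> \<forall>x\<in>E. \<bar>lip0_apply g x\<bar> \<le> s \<Longrightarrow> \<bar>pairing \<nu> g\<bar> \<le> C * s" by blast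
  show thesis
  proof (rule that[OF E(1,2)])
    fix g :: "'a lip0" and s :: real
    assume "0 \<le> s" "\<And>x. x \<in> E \<Longrightarrow> \<bar>lip0_apply g x\<bar> \<le> s"
    then have "\<bar>pairing \<nu> g\<bar> \<le> C * s" by (intro E(3)) auto
    moreover have "\<bar>pairing (\<mu> - \<nu>) g\<bar> \<le> \<eta> * norm g"
      using abs_pairing_le[of "\<mu> - \<nu>" g] \<nu>(2)
        mult_right_mono[of "norm (\<mu> - \<nu>)" \<eta> "norm g"]
      by (simp add: dist_norm norm_minus_commute)
    ultimately show "\<bar>pairing \<mu> g\<bar> \<le> \<eta> * norm g + C * s"
      by (simp add: pairing_simps)
  qed
qed

section \<open>Multiplication operators\<close>

text \<open>The weight \<open>dist x 0\<close> matches the bound \<open>norm f * dist x 0\<close> on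
  the values of \<open>f\<close>, so the oscillation of \<open>h\<close> costs at most
  \<open>L * norm f\<close> in the product rule.\<close>

definition multiplier :: "real \<Rightarrow> ('a::{metric_space, zero} \<Rightarrow> real) \<Rightarrow> bool"
  where "multiplier L h \<longleftrightarrow> 0 \<le> L \<and> (\<forall>x. \<bar>h x\<bar> \<le> 1) \<and>
    (\<forall>x y. \<bar>h x - h y\<bar> * dist x 0 \<le> L * dist x y)"

text \<open>Meaningful when \<open>h\<close> is a \<open>multiplier\<close>; otherwise
  \<open>Lip0\<close> may be applied outside its domain.\<close>

definition mult_lip0 :: "('a::{metric_space, zero} \<Rightarrow> real) \<Rightarrow> 'a lip0 \<Rightarrow> 'a lip0"
  where "mult_lip0 h f = Lip0 (\<lambda>x. h x * lip0_apply f x)"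

lemma lipschitz_on_mult_multiplier:
  assumes "multiplier L h"
  shows "((L + 1) * norm f)-lipschitz_on UNIV (\<lambda>x. h x * lip0_apply f x)"
proof (rule lipschitz_onI)
  have h: "0 \<le> L" "\<bar>h x\<bar> \<le> 1" "\<bar>h x - h y\<bar> * dist x 0 \<le> L * dist x y" for x y
    using assms by (auto simp: multiplier_def)
  show "0 \<le> (L + 1) * norm f" using h(1) by simp
  fix x y :: 'a
  have "\<bar>(h x - h y) * lip0_apply f x\<bar> \<le> \<bar>h x - h y\<bar> * (norm f * dist x 0)"
    unfolding abs_mult by (intro mult_left_mono abs_lip0_apply_le) simp
  also have "\<dots> \<le> norm f * (L * dist x y)"
    using mult_left_mono[OF h(3), of "norm f" x y] by (simp add: ac_simps)
  finally have 1: "\<bar>(h x - h y) * lip0_apply f x\<bar> \<le> norm f * (L * dist x y)" .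
  have "\<bar>h y * (lip0_apply f x - lip0_apply f y)\<bar> \<le> 1 * (norm f * dist x y)"
    unfolding abs_mult using lipschitz_onD[OF lipschitz_on_norm_lip0[of f], of x y]
    by (intro mult_mono h(2)) (auto simp: dist_real_def)
  with 1 have "\<bar>(h x - h y) * lip0_apply f x\<bar> + \<bar>h y * (lip0_apply f x - lip0_apply f y)\<bar>
      \<le> (L + 1) * norm f * dist x y"
    by (simp add: algebra_simps)
  moreover have "h x * lip0_apply f x - h y * lip0_apply f y =
      (h x - h y) * lip0_apply f x + h y * (lip0_apply f x - lip0_apply f y)"
    by (simp add: algebra_simps)
  ultimately show "dist (h x * lip0_apply f x) (h y * lip0_apply f y)
      \<le> (L + 1) * norm f * dist x y"
    unfolding dist_real_def by linarith
qed

lemma lip0_apply_mult_lip0: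
  "multiplier L h \<Longrightarrow> lip0_apply (mult_lip0 h f) x = h x * lip0_apply f x"
  unfolding mult_lip0_def
  by (subst Lip0_inverse) (auto intro: lipschitz_on_mult_multiplier)

lemma norm_mult_lip0_le: "multiplier L h \<Longrightarrow> norm (mult_lip0 h f) \<le> (L + 1) * norm f"
  using lipschitz_on_mult_multiplier[of L h f]
  by (intro norm_lip0_le) (simp add: lip0_apply_mult_lip0)

text \<open>The adjoint \<open>\<Psi>\<close> on the dual sends each point evaluation to a multiple
  of itself. It therefore preserves their span, by continuity also the closure, and restricts to the
  free space.\<close>

lemma exists_preadjoint_mult_lip0:
  fixes h :: "'a::{metric_space, zero} \<Rightarrow> real"
  assumes h: "multiplier L h"
  shows "\<exists>T :: 'a lip_free \<Rightarrow>\<^sub>L 'a lip_free. \<forall>\<mu> f. pairing (T \<mu>) f = pairing \<mu> (mult_lip0 h f)"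
proof -
  have blm: "bounded_linear (mult_lip0 h)"
    using norm_mult_lip0_le[OF h]
    by (intro bounded_linear_intro[of _ "L + 1"] lip0_eqI)
      (auto simp: lip0_apply_mult_lip0[OF h] plus_lip0.rep_eq scaleR_lip0.rep_eq algebra_simps)
  define M where "M = Blinfun (mult_lip0 h)"
  have M: "blinfun_apply M = mult_lip0 h"
    unfolding M_def by (rule bounded_linear_Blinfun_apply[OF blm])
  define \<Psi> where "\<Psi> = (\<lambda>\<phi> :: 'a lip0 \<Rightarrow>\<^sub>L real. \<phi> o\<^sub>L M)"
  have bl\<Psi>: "bounded_linear \<Psi>"
    unfolding \<Psi>_def by (rule bounded_bilinear.bounded_linear_left[OF bounded_bilinear_blinfun_compose])
  have "\<Psi> (delta_dual x) = h x *\<^sub>R delta_dual x" for x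
    by (rule blinfun_eqI)
      (simp add: \<Psi>_def M delta_dual.rep_eq lip0_apply_mult_lip0[OF h] scaleR_blinfun.rep_eq)
  then have base: "\<Psi> (delta_dual x) \<in> span (range delta_dual)" for x
    by (simp add: span_scale span_base)
  have "\<Psi> \<phi> \<in> span (range delta_dual)" if "\<phi> \<in> span (range delta_dual)" for \<phi>
    using that
    by (induction rule: span_induct_alt)
      (auto simp: bounded_linear.linear[OF bl\<Psi>] linear_0 linear_add linear_scale base
        intro!: span_zero span_add span_scale)
  then have "\<Psi> ` closure (span (range delta_dual)) \<subseteq> closure (span (range delta_dual))"
    by (intro image_closure_subset[OF bounded_linear.continuous_on[OF bl\<Psi> continuous_on_id]])
      (auto intro: subsetD[OF closure_subset])
  then have mem: "\<Psi> (free_to_dual \<mu>) \<in> closure (span (range delta_dual))" for \<mu> :: "'a lip_free"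
    using free_to_dual[of \<mu>] by blast
  define T where "T \<mu> = Free_of_dual (\<Psi> (free_to_dual \<mu>))" for \<mu> :: "'a lip_free"
  have T: "pairing (T \<mu>) f = pairing \<mu> (mult_lip0 h f)" for \<mu> f
    unfolding pairing_def T_def Free_of_dual_inverse[OF mem] by (simp add: \<Psi>_def M)
  have "bounded_linear T"
  proof (rule bounded_linear_intro[of _ "L + 1"])
    show "T (\<mu> + \<nu>) = T \<mu> + T \<nu>" for \<mu> \<nu> by (rule lip_free_eqI) (simp add: T pairing_simps)
    show "T (c *\<^sub>R \<mu>) = c *\<^sub>R T \<mu>" for c \<mu> by (rule lip_free_eqI) (simp add: T pairing_simps)
    show "norm (T \<mu>) \<le> norm \<mu> * (L + 1)" for \<mu>
    proof (rule norm_lip_free_le)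
      show "0 \<le> norm \<mu> * (L + 1)" using h by (simp add: multiplier_def)
      show "\<bar>pairing (T \<mu>) f\<bar> \<le> norm \<mu> * (L + 1) * norm f" for f
        using abs_pairing_le[of \<mu> "mult_lip0 h f"]
          mult_left_mono[OF norm_mult_lip0_le[OF h, of f] norm_ge_zero[of \<mu>]]
        by (simp add: T mult.assoc)
    qed
  qed
  then show ?thesis
    using T by (intro exI[of _ "Blinfun T"]) (simp add: bounded_linear_Blinfun_apply)
qed

lemma multiplier_one: "multiplier 0 (\<lambda>_. 1)"
  by (simp add: multiplier_def)

text \<open>The constants add, rather than multiply, because both factors are bounded by 1.\<close>

lemma multiplier_mult:
  assumes "multiplier L h" "multiplier L' h'"
  shows "multiplier (L + L') (\<lambda>x. h x * h' x)"
  unfolding multiplier_def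
proof (intro conjI allI)
  have h: "0 \<le> L" "\<bar>h x\<bar> \<le> 1" "\<bar>h x - h y\<bar> * dist x 0 \<le> L * dist x y"
    and h': "0 \<le> L'" "\<bar>h' x\<bar> \<le> 1" "\<bar>h' x - h' y\<bar> * dist x 0 \<le> L' * dist x y" for x y
    using assms by (auto simp: multiplier_def)
  show "0 \<le> L + L'" using h(1) h'(1) by simp
  fix x y :: 'a
  show "\<bar>h x * h' x\<bar> \<le> 1" using h(2)[of x] h'(2)[of x] by (simp add: abs_mult mult_le_one)
  have "\<bar>h x * h' x - h y * h' y\<bar> = \<bar>(h x - h y) * h' x + h y * (h' x - h' y)\<bar>"
    by (simp add: algebra_simps)
  also have "\<dots> \<le> \<bar>h x - h y\<bar> * \<bar>h' x\<bar> + \<bar>h y\<bar> * \<bar>h' x - h' y\<bar>"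
    by (metis abs_mult abs_triangle_ineq)
  also have "\<dots> \<le> \<bar>h x - h y\<bar> * 1 + 1 * \<bar>h' x - h' y\<bar>"
    by (intro add_mono mult_mono h(2) h'(2)) auto
  finally have "\<bar>h x * h' x - h y * h' y\<bar> * dist x 0 \<le>
      (\<bar>h x - h y\<bar> + \<bar>h' x - h' y\<bar>) * dist x 0"
    by (intro mult_right_mono) auto
  with h(3)[of x y] h'(3)[of x y]
  show "\<bar>h x * h' x - h y * h' y\<bar> * dist x 0 \<le> (L + L') * dist x y"
    by (simp add: algebra_simps)
qed

lemma multiplier_prod:
  assumes "finite I" "\<And>i. i \<in> I \<Longrightarrow> multiplier (L i) (h i)"
  shows "multiplier (\<Sum>i\<in>I. L i) (\<lambda>x. \<Prod>i\<in>I. h i x)"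
  using assms by (induction I rule: finite_induct) (auto simp: multiplier_one multiplier_mult)

section \<open>Cutoffs around finite sets\<close>

definition expansion :: "real \<Rightarrow> 'a::{metric_space, zero} set \<Rightarrow> 'a set"
  where "expansion \<delta> E = {x. infdist x E \<le> \<delta> * (1 + dist x 0)}"

text \<open>The ramp is taken in the ratio to the scaled radius, so that its slope decays like the
  inverse of \<open>1 + dist x 0\<close>, as \<open>multiplier\<close> demands.\<close>

definition cutoff :: "real \<Rightarrow> 'a::{metric_space, zero} set \<Rightarrow> 'a \<Rightarrow> real"
  where "cutoff \<delta> E x = 2 - max 1 (min 2 (infdist x E / (\<delta> * (1 + dist x 0))))"

lemma cutoff_bounds: "0 \<le> cutoff \<delta> E x" "cutoff \<delta> E x \<le> 1"
  by (auto simp: cutoff_def)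

lemma one_plus_dist_pos: "0 < 1 + dist x y"
  by (rule add_pos_nonneg) auto

lemma cutoff_eq_1:
  assumes "0 < \<delta>" "x \<in> expansion \<delta> E"
  shows "cutoff \<delta> E x = 1"
proof -
  have "0 < \<delta> * (1 + dist x 0)"
    using assms(1) one_plus_dist_pos by (rule mult_pos_pos)
  then have "infdist x E / (\<delta> * (1 + dist x 0)) \<le> 1"
    using assms(2) by (subst pos_divide_le_eq) (auto simp: expansion_def)
  then show ?thesis by (simp add: cutoff_def)
qed

lemma cutoff_eq_0: "0 < \<delta> \<Longrightarrow> x \<notin> expansion (2 * \<delta>) E \<Longrightarrow> cutoff \<delta> E x = 0"
  using one_plus_dist_pos[of x 0]
  by (simp add: cutoff_def expansion_def le_divide_eq max_def min_def not_le ac_simps)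

text \<open>Nonemptiness excludes the convention \<open>infdist x {} = 0\<close>, under which the
  expansion of the empty set is the whole space.\<close>

lemma expansion_mono: "0 < \<delta> \<Longrightarrow> E \<noteq> {} \<Longrightarrow> E \<subseteq> E' \<Longrightarrow> expansion \<delta> E \<subseteq> expansion \<delta> E'"
  by (auto simp: expansion_def intro: order_trans[OF infdist_mono])

lemma subset_expansion: "0 < \<delta> \<Longrightarrow> E \<subseteq> expansion \<delta> E"
  by (auto simp: expansion_def)

lemma closed_expansion: "closed (expansion \<delta> E)"
  unfolding expansion_def by (intro closed_Collect_le continuous_intros)

text \<open>The cutoff is \<open>2 - q / w\<close> with \<open>q\<close> Lipschitz of constant
  \<open>1 / \<delta> + 2\<close>, \<open>w\<close> of constant 1, and
  \<open>0 \<le> q \<le> 2 * w\<close>. The quotient rule adds a further 2 to the constant of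
  \<open>q\<close>.\<close>

lemma multiplier_cutoff:
  assumes \<delta>: "0 < \<delta>"
  shows "multiplier (1 / \<delta> + 4) (cutoff \<delta> E)"
proof -
  define w where "w x = 1 + dist x 0" for x :: 'a
  define q where "q x = max (w x) (min (2 * w x) (infdist x E / \<delta>))" for x
  have w: "0 < w x" for x by (simp add: w_def one_plus_dist_pos)
  have cut: "cutoff \<delta> E x = 2 - q x / w x" for x
    using w[of x] \<delta>
    by (auto simp: cutoff_def q_def max_def min_def field_simps w_def[symmetric])
  have wdist: "\<bar>w x - w y\<bar> \<le> dist x y" for x y
    using dist_triangle3[of x 0 y] dist_triangle3[of y 0 x]
    by (simp add: w_def dist_commute abs_le_iff)
  have qdist: "\<bar>q x - q y\<bar> \<le> (1 / \<delta> + 2) * dist x y" for x y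
  proof -
    have "\<bar>infdist x E - infdist y E\<bar> \<le> dist x y"
      using infdist_triangle_abs[of x E y] .
    then have 1: "\<bar>infdist x E / \<delta> - infdist y E / \<delta>\<bar> \<le> 1 / \<delta> * dist x y"
      using \<delta> by (simp add: divide_right_mono flip: diff_divide_distrib)
    have 2: "0 \<le> 1 / \<delta> * dist x y" using \<delta> by simp
    have "\<bar>q x - q y\<bar> \<le> 2 * dist x y + 1 / \<delta> * dist x y"
      unfolding q_def using 1 2 wdist[of x y] zero_le_dist[of x y] by linarith
    then show ?thesis by (simp add: algebra_simps)
  qed
  have q: "0 \<le> q y" "q y \<le> 2 * w y" for y using w[of y] by (auto simp: q_def)
  show ?thesis
    unfolding multiplier_def
  proof (intro conjI allI)
    show "0 \<le> 1 / \<delta> + 4" using \<delta> by simp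
    fix x y :: 'a
    show "\<bar>cutoff \<delta> E x\<bar> \<le> 1" using cutoff_bounds[of \<delta> E x] by simp
    have "\<bar>cutoff \<delta> E x - cutoff \<delta> E y\<bar> * dist x 0 \<le> \<bar>cutoff \<delta> E x - cutoff \<delta> E y\<bar> * w x"
      by (intro mult_left_mono) (auto simp: w_def)
    also have "\<dots> = \<bar>(cutoff \<delta> E x - cutoff \<delta> E y) * w x\<bar>"
      using w[of x] by (simp add: abs_mult)
    also have "(cutoff \<delta> E x - cutoff \<delta> E y) * w x = (q y - q x) + q y / w y * (w x - w y)"
      using w[of x] w[of y] by (simp add: cut field_simps)
    also have "\<bar>\<dots>\<bar> \<le> \<bar>q x - q y\<bar> + \<bar>q y / w y\<bar> * \<bar>w x - w y\<bar>"
      by (metis abs_minus_commute abs_mult abs_triangle_ineq)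
    also have "\<dots> \<le> (1 / \<delta> + 2) * dist x y + 2 * dist x y"
      using q[of y] w[of y]
      by (intro add_mono mult_mono qdist wdist) (auto simp: divide_le_eq)
    finally show "\<bar>cutoff \<delta> E x - cutoff \<delta> E y\<bar> * dist x 0 \<le> (1 / \<delta> + 4) * dist x y"
      by (simp add: algebra_simps)
  qed
qed

lemma multiplier_one_minus:
  assumes "multiplier L h" "\<And>x. 0 \<le> h x"
  shows "multiplier L (\<lambda>x. 1 - h x)"
  using assms by (auto simp: multiplier_def abs_le_iff abs_minus_commute)

section \<open>Gliding hump\<close>

text \<open>\<open>G A\<close> is the pointwise sum of the bumps in \<open>A\<close>. For two given
  points at most two bumps are involved, one active at each, so the Lipschitz constant stays below
  \<open>2 * C\<close> however large \<open>A\<close> is.\<close>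

lemma exists_disjoint_sums:
  fixes g :: "nat \<Rightarrow> 'a::{metric_space, zero} lip0"
  assumes C: "\<And>n. norm (g n) \<le> C"
    and disj: "\<forall>m n x. lip0_apply (g m) x \<noteq> 0 \<longrightarrow> lip0_apply (g n) x \<noteq> 0 \<longrightarrow> m = n"
  shows "\<exists>G :: nat set \<Rightarrow> 'a lip0. (\<forall>A. norm (G A) \<le> 2 * C) \<and>
    (\<forall>A x n. lip0_apply (g n) x \<noteq> 0 \<longrightarrow> lip0_apply (G A) x = (if n \<in> A then lip0_apply (g n) x else 0)) \<and>
    (\<forall>A x. (\<forall>n. lip0_apply (g n) x = 0) \<longrightarrow> lip0_apply (G A) x = 0)"
proof -
  define \<Gamma> where "\<Gamma> A x = (\<Sum>n | n \<in> A \<and> lip0_apply (g n) x \<noteq> 0. lip0_apply (g n) x)" for A x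
  \<comment> \<open>Here \<open>n\<close> is merely the sole candidate for a bump active at
    \<open>x\<close>; where none is active, any \<open>n\<close> qualifies and both sides are
    0.\<close>
  have \<Gamma>: "\<Gamma> A x = (if n \<in> A then lip0_apply (g n) x else 0)"
    if "\<And>m. lip0_apply (g m) x \<noteq> 0 \<Longrightarrow> m = n" for A x n
  proof -
    have "{m. m \<in> A \<and> lip0_apply (g m) x \<noteq> 0} = (if n \<in> A \<and> lip0_apply (g n) x \<noteq> 0 then {n} else {})"
      using that by auto
    then show ?thesis by (auto simp: \<Gamma>_def)
  qed
  have ex: "\<exists>n. \<forall>m. lip0_apply (g m) x \<noteq> 0 \<longrightarrow> m = n" for x
    using disj by blast
  have "0 \<le> C" using C[of 0] norm_ge_zero order_trans by blast
  have lip: "(2 * C)-lipschitz_on UNIV (\<Gamma> A)" for A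
  proof (rule lipschitz_onI)
    show "0 \<le> 2 * C" using \<open>0 \<le> C\<close> by simp
    fix x y :: 'a
    obtain n where n: "\<And>m. lip0_apply (g m) x \<noteq> 0 \<Longrightarrow> m = n" using ex[of x] by blast
    obtain m where m: "\<And>k. lip0_apply (g k) y \<noteq> 0 \<Longrightarrow> k = m" using ex[of y] by blast
    have gd: "\<bar>lip0_apply (g k) x - lip0_apply (g k) y\<bar> \<le> C * dist x y" for k
      using lipschitz_onD[OF lipschitz_on_norm_lip0[of "g k"], of x y]
        mult_right_mono[OF C[of k] zero_le_dist[of x y]] by (simp add: dist_real_def)
    have "0 \<le> C * dist x y" using \<open>0 \<le> C\<close> by simp
    moreover have "n = m \<or> lip0_apply (g n) y = 0" "n = m \<or> lip0_apply (g m) x = 0"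
      using n m by blast+
    ultimately show "dist (\<Gamma> A x) (\<Gamma> A y) \<le> 2 * C * dist x y"
      using gd[of n] gd[of m] by (auto simp: \<Gamma>[OF n] \<Gamma>[OF m] dist_real_def)
  qed
  have "\<Gamma> A 0 = 0" for A by (simp add: \<Gamma>_def)
  with lip have app: "lip0_apply (Lip0 (\<Gamma> A)) x = \<Gamma> A x" for A x
    by (subst Lip0_inverse) auto
  show ?thesis
  proof (intro exI[of _ "\<lambda>A. Lip0 (\<Gamma> A)"] conjI allI impI)
    show "norm (Lip0 (\<Gamma> A)) \<le> 2 * C" for A
      using lip by (intro norm_lip0_le) (simp add: app)
    show "lip0_apply (Lip0 (\<Gamma> A)) x = (if n \<in> A then lip0_apply (g n) x else 0)"
      if "lip0_apply (g n) x \<noteq> 0" for A x n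
      unfolding app using disj that by (intro \<Gamma>) blast
    show "lip0_apply (Lip0 (\<Gamma> A)) x = 0" if "\<forall>n. lip0_apply (g n) x = 0" for A x
      by (simp add: app \<Gamma>_def that)
  qed
qed

text \<open>Subtracting from each \<open>\<mu> i\<close> a later term of the sequence gives a weakly null sequence
  \<open>\<nu>\<close> that still has large values on the bumps \<open>g (n i)\<close>. Along a sparse set \<open>A\<close>
  of bumps, the values of \<open>\<nu>\<close> on the sum of the bumps in \<open>A\<close> do not tend to \<open>0\<close>.\<close>

lemma weakly_Cauchy_disjoint_bumps_False:
  fixes g :: "nat \<Rightarrow> 'a::{metric_space, zero} lip0"
  assumes W: "weakly_Cauchy \<mu>"
    and C: "\<And>n. norm (g n) \<le> C"
    and disj: "\<And>m n x. lip0_apply (g m) x \<noteq> 0 \<Longrightarrow> lip0_apply (g n) x \<noteq> 0 \<Longrightarrow> m = n"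
    and c: "0 < c" "\<And>n. c < pairing (\<mu> n) (g n)"
  shows False
proof -
  have "\<forall>m n x. lip0_apply (g m) x \<noteq> 0 \<longrightarrow> lip0_apply (g n) x \<noteq> 0 \<longrightarrow> m = n"
    using disj by blast
  from exists_disjoint_sums[OF C this] obtain G where G0: "(\<forall>A. norm (G A) \<le> 2 * C) \<and>
      (\<forall>A x n. lip0_apply (g n) x \<noteq> 0 \<longrightarrow>
        lip0_apply (G A) x = (if n \<in> A then lip0_apply (g n) x else 0)) \<and>
      (\<forall>A x. (\<forall>n. lip0_apply (g n) x = 0) \<longrightarrow> lip0_apply (G A) x = 0)"
    by (elim exE)
  have G: "norm (G A) \<le> 2 * C"
    "lip0_apply (g n) x \<noteq> 0 \<Longrightarrow> lip0_apply (G A) x = (if n \<in> A then lip0_apply (g n) x else 0)"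
    "(\<And>n. lip0_apply (g n) x = 0) \<Longrightarrow> lip0_apply (G A) x = 0" for A x n
    using G0 by simp_all
  have G_Un: "G (A \<union> B) = G A + G B" if "A \<inter> B = {}" for A B
  proof (rule lip0_eqI)
    fix x
    show "lip0_apply (G (A \<union> B)) x = lip0_apply (G A + G B) x"
    proof (cases "\<exists>n. lip0_apply (g n) x \<noteq> 0")
      case True
      then obtain n where "lip0_apply (g n) x \<noteq> 0" ..
      with that show ?thesis by (auto simp: G(2) plus_lip0.rep_eq)
    qed (simp add: G(3) plus_lip0.rep_eq)
  qed
  have G_single: "G {n} = g n" for n
  proof (rule lip0_eqI)
    fix x
    show "lip0_apply (G {n}) x = lip0_apply (g n) x"
    proof (cases "\<exists>n. lip0_apply (g n) x \<noteq> 0")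
      case True
      then obtain m where "lip0_apply (g m) x \<noteq> 0" ..
      with disj[of m x n] show ?thesis by (auto simp: G(2))
    qed (simp add: G(3))
  qed
  have "0 \<le> C" using C[of 0] norm_ge_zero order_trans by blast
  \<comment> \<open>Up to a small error \<open>\<nu>\<close> sees only finitely many points, and
    each point meets at most one bump, so all late bumps vanish there. The divisor
    \<open>2 * C + 1\<close> is positive even if \<open>C = 0\<close>.\<close>
  have tail: "\<exists>N. \<forall>A\<subseteq>{N..}. \<bar>pairing \<nu> (G A)\<bar> \<le> \<eta>" if "0 < \<eta>" for \<nu> \<eta>
  proof -
    have pos: "0 < \<eta> / (2 * C + 1)" using that \<open>0 \<le> C\<close> by simp
    obtain E D where E: "finite E" "0 \<le> D" "\<And>g s. 0 \<le> s \<Longrightarrow>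
        (\<And>x. x \<in> E \<Longrightarrow> \<bar>lip0_apply g x\<bar> \<le> s) \<Longrightarrow>
        \<bar>pairing \<nu> g\<bar> \<le> \<eta> / (2 * C + 1) * norm g + D * s"
      using pairing_approx[OF pos, of \<nu>] by blast
    have "\<exists>N. \<forall>n\<ge>N. lip0_apply (g n) x = 0" for x
    proof (cases "\<exists>m. lip0_apply (g m) x \<noteq> 0")
      case True
      then obtain m where "lip0_apply (g m) x \<noteq> 0" ..
      then have "lip0_apply (g n) x = 0" if "Suc m \<le> n" for n
        using disj[of m x n] that by (cases "lip0_apply (g n) x = 0") auto
      then show ?thesis by blast
    qed simp
    then obtain N where N: "\<And>x n. N x \<le> n \<Longrightarrow> lip0_apply (g n) x = 0" by metis
    define M where "M = (\<Sum>x\<in>E. N x)"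
    have M: "N x \<le> M" if "x \<in> E" for x
      unfolding M_def using E(1) that by (intro member_le_sum) auto
    have "\<bar>pairing \<nu> (G A)\<bar> \<le> \<eta>" if "A \<subseteq> {M..}" for A
    proof -
      have "lip0_apply (G A) x = 0" if "x \<in> E" for x
      proof (cases "\<exists>n. lip0_apply (g n) x \<noteq> 0")
        case True
        then obtain n where n: "lip0_apply (g n) x \<noteq> 0" ..
        with N M[OF that] have "n < M" by (meson not_le order_trans)
        with n \<open>A \<subseteq> {M..}\<close> show ?thesis by (auto simp: G(2))
      qed (simp add: G(3))
      then have "\<bar>pairing \<nu> (G A)\<bar> \<le> \<eta> / (2 * C + 1) * norm (G A)"
        using E(3)[of 0 "G A"] by simp
      also have "\<dots> \<le> \<eta> / (2 * C + 1) * (2 * C + 1)"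
        using pos G(1)[of A] by (intro mult_left_mono) auto
      also have "\<dots> = \<eta>" using \<open>0 \<le> C\<close> by simp
      finally show ?thesis .
    qed
    then show ?thesis by blast
  qed
  have "\<exists>n>i. \<bar>pairing (\<mu> i) (g n)\<bar> \<le> c / 2" for i
  proof -
    obtain N where N: "\<forall>A\<subseteq>{N..}. \<bar>pairing (\<mu> i) (G A)\<bar> \<le> c / 2"
      using tail[of "c / 2" "\<mu> i"] c(1) by auto
    then have "\<bar>pairing (\<mu> i) (G {max N (Suc i)})\<bar> \<le> c / 2" by simp
    then show ?thesis by (intro exI[of _ "max N (Suc i)"]) (auto simp: G_single)
  qed
  then obtain n where n: "\<And>i. i < n i" "\<And>i. \<bar>pairing (\<mu> i) (g (n i))\<bar> \<le> c / 2" by metis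
  define \<nu> where "\<nu> i = \<mu> (n i) - \<mu> i" for i
  have hump: "c / 2 < pairing (\<nu> i) (g (n i))" for i
    using c(2)[of "n i"] n(2)[of i] by (simp add: \<nu>_def pairing_simps)
  \<comment> \<open>Since \<open>i < n i\<close>, the pairings of \<open>\<mu> (n i)\<close> and
    \<open>\<mu> i\<close> with \<open>f\<close> have the same limit.\<close>
  have null: "(\<lambda>i. pairing (\<nu> i) f) \<longlonglongrightarrow> 0" for f
  proof -
    obtain l where l: "(\<lambda>i. pairing (\<mu> i) f) \<longlonglongrightarrow> l"
      using weakly_Cauchy_pairing[OF W] by (auto simp: convergent_def)
    have "filterlim n at_top sequentially"
      by (intro filterlim_at_top_mono[OF filterlim_ident] always_eventually allI less_imp_le n(1))
    from tendsto_diff[OF filterlim_compose[OF l this] l]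
    show ?thesis by (simp add: \<nu>_def pairing_simps)
  qed
  have "\<exists>M>n i. \<forall>A\<subseteq>{M..}. \<bar>pairing (\<nu> i) (G A)\<bar> \<le> c / 8" for i
  proof -
    obtain N where N: "\<forall>A\<subseteq>{N..}. \<bar>pairing (\<nu> i) (G A)\<bar> \<le> c / 8"
      using tail[of "c / 8" "\<nu> i"] c(1) by auto
    have "{max N (Suc (n i))..} \<subseteq> {N..}" by auto
    with N have "\<forall>A\<subseteq>{max N (Suc (n i))..}. \<bar>pairing (\<nu> i) (G A)\<bar> \<le> c / 8"
      by (meson subset_trans)
    then show ?thesis by (intro exI[of _ "max N (Suc (n i))"]) simp
  qed
  then obtain M where M: "\<And>i. n i < M i" "\<And>i A. A \<subseteq> {M i..} \<Longrightarrow> \<bar>pairing (\<nu> i) (G A)\<bar> \<le> c / 8"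
    by metis
  \<comment> \<open>There are finitely many subsets of \<open>{..<K}\<close>, so the convergence to
    0 is uniform over them.\<close>
  have "\<exists>i\<ge>K. \<forall>A\<in>Pow {..<K}. \<bar>pairing (\<nu> i) (G A)\<bar> < c / 8" for K :: nat
  proof -
    have "\<forall>\<^sub>F i in sequentially. \<bar>pairing (\<nu> i) (G A)\<bar> < c / 8" for A
      using tendstoD[OF null[of "G A"], of "c / 8"] c(1) by (simp add: dist_real_def)
    then have "\<forall>\<^sub>F i in sequentially. \<forall>A\<in>Pow {..<K}. \<bar>pairing (\<nu> i) (G A)\<bar> < c / 8"
      by (intro eventually_ball_finite) auto
    with eventually_ge_at_top[of K]
    have "\<forall>\<^sub>F i in sequentially. K \<le> i \<and> (\<forall>A\<in>Pow {..<K}. \<bar>pairing (\<nu> i) (G A)\<bar> < c / 8)"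
      by (rule eventually_conj)
    from eventually_happens'[OF _ this] show ?thesis by auto
  qed
  then obtain J where "\<forall>K :: nat. K \<le> J K \<and>
      (\<forall>A\<in>Pow {..<K}. \<bar>pairing (\<nu> (J K)) (G A)\<bar> < c / 8)"
    by metis
  then have J: "K \<le> J K" "A \<subseteq> {..<K} \<Longrightarrow> \<bar>pairing (\<nu> (J K)) (G A)\<bar> < c / 8" for A K
    by auto
  \<comment> \<open>With \<open>s (Suc j) = J (M (s j))\<close>, bumps with index below
    \<open>M (s j)\<close> contribute little to \<open>\<nu> (s (Suc j))\<close>, while its own bump
    has index at least \<open>M (s j)\<close>.\<close>
  define s where "s j = ((\<lambda>i. J (M i)) ^^ j) 0" for j
  have s_Suc: "s (Suc j) = J (M (s j))" for j by (simp add: s_def)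
  have Ms: "M (s j) \<le> s (Suc j)" for j by (simp add: s_Suc J(1))
  have "s j < s (Suc j)" for j
    using n(1)[of "s j"] M(1)[of "s j"] Ms[of j] by linarith
  then have smono: "strict_mono s" by (rule strict_monoI_Suc)
  have less: "M (s i) \<le> s j" if "i < j" for i j
    using Ms[of i] strict_mono_less_eq[OF smono, of "Suc i" j] that by (meson Suc_leI order_trans)
  define A where "A = range (\<lambda>j. n (s j))"
  \<comment> \<open>At \<open>?i\<close> the set \<open>A\<close> splits into earlier indices, the
    index \<open>n ?i\<close> and later indices. The hump exceeds \<open>c / 2\<close>, and the
    other two parts cost at most \<open>c / 8\<close> each.\<close>
  have big: "c / 4 \<le> pairing (\<nu> (s (Suc j))) (G A)" for j
  proof -
    let ?i = "s (Suc j)"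
    define B D where "B = A \<inter> {..<M (s j)}" and "D = A \<inter> {M ?i..}"
    have mid: "M (s j) \<le> n ?i" "n ?i < M ?i"
      using n(1)[of ?i] M(1)[of ?i] Ms[of j] by linarith+
    have A: "A = (B \<union> {n ?i}) \<union> D"
    proof
      show "A \<subseteq> (B \<union> {n ?i}) \<union> D"
      proof
        fix a assume "a \<in> A"
        then obtain k where k: "a = n (s k)" by (auto simp: A_def)
        consider "k \<le> j" | "k = Suc j" | "Suc j < k" by linarith
        then show "a \<in> (B \<union> {n ?i}) \<union> D"
        proof cases
          case 1
          \<comment> \<open>\<open>M\<close> need not be monotone; for \<open>k < j\<close> the
            chain is \<open>M (s k) \<le> s j < n (s j) < M (s j)\<close>.\<close>
          have "M (s k) \<le> M (s j)"
            using 1 less[of k j] n(1)[of "s j"] M(1)[of "s j"] by (cases "k = j") auto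
          with M(1)[of "s k"] \<open>a \<in> A\<close> show ?thesis by (auto simp: B_def k)
        next
          case 3
          with less[of "Suc j" k] n(1)[of "s k"] \<open>a \<in> A\<close> show ?thesis by (auto simp: D_def k)
        qed (simp add: k)
      qed
    qed (auto simp: A_def B_def D_def)
    have "G A = G B + g (n ?i) + G D"
    proof -
      have "G ((B \<union> {n ?i}) \<union> D) = G (B \<union> {n ?i}) + G D"
        using mid by (intro G_Un) (auto simp: B_def D_def)
      also have "G (B \<union> {n ?i}) = G B + g (n ?i)"
        using mid by (subst G_Un) (auto simp: B_def G_single)
      finally show ?thesis unfolding A[symmetric] .
    qed
    moreover have "\<bar>pairing (\<nu> ?i) (G B)\<bar> < c / 8"
      unfolding s_Suc by (intro J(2)) (auto simp: B_def)
    moreover have "\<bar>pairing (\<nu> ?i) (G D)\<bar> \<le> c / 8"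
      by (intro M(2)) (auto simp: D_def)
    ultimately show ?thesis
      using hump[of ?i] by (simp add: pairing_simps abs_le_iff abs_less_iff)
  qed
  have "(\<lambda>j. pairing (\<nu> (s (Suc j))) (G A)) \<longlonglongrightarrow> 0"
    using LIMSEQ_Suc[OF LIMSEQ_subseq_LIMSEQ[OF null smono, of "G A"]] by (simp add: o_def)
  then have "c / 4 \<le> 0"
    using big by (intro LIMSEQ_le_const) auto
  with c(1) show False by simp
qed

lemma weakly_precompact_disjoint_bumps_False:
  fixes g :: "nat \<Rightarrow> 'a::{metric_space, zero} lip0"
  assumes W: "weakly_precompact W" and \<mu>: "\<And>n. \<mu> n \<in> W"
    and C: "\<And>n. norm (g n) \<le> C"
    and disj: "\<And>m n x. lip0_apply (g m) x \<noteq> 0 \<Longrightarrow> lip0_apply (g n) x \<noteq> 0 \<Longrightarrow> m = n"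
    and c: "0 < c" "\<And>n. c < pairing (\<mu> n) (g n)"
  shows False
proof -
  obtain r where r: "strict_mono r" "weakly_Cauchy (\<mu> \<circ> r)"
    using W \<mu> unfolding weakly_precompact_def by blast
  show False
  proof (rule weakly_Cauchy_disjoint_bumps_False[OF r(2)])
    show "m = n" if "lip0_apply ((g \<circ> r) m) x \<noteq> 0" "lip0_apply ((g \<circ> r) n) x \<noteq> 0" for m n x
      using disj[of "r m" x "r n"] that r(1) by (simp add: strict_mono_eq)
  qed (use C c in auto)
qed

section \<open>Concentration near finite sets\<close>

text \<open>Otherwise finite sets \<open>F n\<close> can be built successively with bumps that
  vanish on the expansion of \<open>F n\<close> and outside that of \<open>F (Suc n)\<close>. These
  bumps are disjointly supported, which the gliding hump excludes.\<close>

lemma weakly_precompact_concentrated: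
  fixes W :: "'a::{metric_space, zero} lip_free set"
  assumes W: "weakly_precompact W" and \<delta>: "0 < \<delta>" and \<epsilon>: "0 < \<epsilon>"
  shows "\<exists>E. finite E \<and> 0 \<in> E \<and> (\<forall>\<mu>\<in>W. \<forall>f. (\<forall>x\<in>expansion \<delta> E. lip0_apply f x = 0) \<longrightarrow>
    \<bar>pairing \<mu> f\<bar> \<le> \<epsilon> * norm f)"
proof (rule ccontr)
  assume contr: "\<not> ?thesis"
  \<comment> \<open>Half the radius is used because a cutoff vanishes only outside the doubled
    expansion, which then has parameter \<open>\<delta>\<close> again.\<close>
  define L where "L = 1 / (\<delta> / 2) + 4"
  have mult: "multiplier L (cutoff (\<delta> / 2) E)" for E :: "'a set"
    unfolding L_def using \<delta> by (intro multiplier_cutoff) simp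
  have L: "0 \<le> L" using \<delta> by (simp add: L_def)
  define Q where "Q E E' \<mu> g \<longleftrightarrow> (finite E' \<and> 0 \<in> E') \<and> E \<subseteq> E' \<and> \<mu> \<in> W \<and>
      norm g \<le> L + 1 \<and> \<epsilon> / 2 < pairing \<mu> g \<and>
      (\<forall>x\<in>expansion \<delta> E. lip0_apply g x = 0) \<and>
      (\<forall>x. x \<notin> expansion \<delta> E' \<longrightarrow> lip0_apply g x = 0)" for E E' \<mu> g
  have step: "\<exists>E' \<mu> g. Q E E' \<mu> g"
    if E: "finite E \<and> 0 \<in> E" for E :: "'a set"
  proof -
    obtain \<mu> f0 where f0: "\<mu> \<in> W" "\<forall>x\<in>expansion \<delta> E. lip0_apply f0 x = 0"
        "\<epsilon> * norm f0 < \<bar>pairing \<mu> f0\<bar>"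
      using contr E by (metis not_le)
    then have "f0 \<noteq> 0" by (auto simp: pairing_simps)
    \<comment> \<open>Normalisation together with the sign makes the pairing positive and larger
      than \<open>\<epsilon>\<close>.\<close>
    define f where "f = (sgn (pairing \<mu> f0) / norm f0) *\<^sub>R f0"
    have f: "norm f \<le> 1" "\<epsilon> < pairing \<mu> f" "\<forall>x\<in>expansion \<delta> E. lip0_apply f x = 0"
      using f0 \<open>f0 \<noteq> 0\<close>
      by (auto simp: f_def pairing_simps scaleR_lip0.rep_eq sgn_if field_simps split: if_splits)
    have pos: "0 < \<epsilon> / (2 * (L + 1))" using \<epsilon> L by simp
    obtain S D where S: "finite S" "0 \<le> D" "\<And>g s. 0 \<le> s \<Longrightarrow>
        (\<And>x. x \<in> S \<Longrightarrow> \<bar>lip0_apply g x\<bar> \<le> s) \<Longrightarrow>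
        \<bar>pairing \<mu> g\<bar> \<le> \<epsilon> / (2 * (L + 1)) * norm g + D * s"
      using pairing_approx[OF pos, of \<mu>] by blast
    \<comment> \<open>Adding \<open>S\<close> makes \<open>1 - u\<close> vanish at the points that
      \<open>\<mu>\<close> sees, so cutting \<open>f\<close> down to \<open>u * f\<close> loses at
      most \<open>\<epsilon> / 2\<close> in the pairing.\<close>
    define E' where "E' = E \<union> S"
    define u where "u = cutoff (\<delta> / 2) E'"
    have mu: "multiplier L u" "multiplier L (\<lambda>x. 1 - u x)"
      unfolding u_def by (auto intro!: mult multiplier_one_minus simp: cutoff_bounds)
    have "u x = 1" if "x \<in> S" for x
      unfolding u_def using \<delta> that subset_expansion[of "\<delta> / 2" E']
      by (intro cutoff_eq_1) (auto simp: E'_def)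
    then have "\<bar>pairing \<mu> (mult_lip0 (\<lambda>x. 1 - u x) f)\<bar> \<le>
        \<epsilon> / (2 * (L + 1)) * norm (mult_lip0 (\<lambda>x. 1 - u x) f) + D * 0"
      by (intro S(3)) (auto simp: lip0_apply_mult_lip0[OF mu(2)])
    also have "\<dots> \<le> \<epsilon> / (2 * (L + 1)) * (L + 1)"
    proof -
      have "norm (mult_lip0 (\<lambda>x. 1 - u x) f) \<le> (L + 1) * 1"
        using f(1) L by (intro order_trans[OF norm_mult_lip0_le[OF mu(2)]] mult_left_mono) auto
      then show ?thesis using mult_left_mono[OF _ less_imp_le[OF pos]] by simp
    qed
    also have "\<dots> = \<epsilon> / 2"
      using L by (subst times_divide_eq_left, subst mult_divide_mult_cancel_right) auto
    finally have "\<bar>pairing \<mu> (mult_lip0 (\<lambda>x. 1 - u x) f)\<bar> \<le> \<epsilon> / 2" .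
    moreover have "f = mult_lip0 u f + mult_lip0 (\<lambda>x. 1 - u x) f"
      by (rule lip0_eqI)
        (simp add: plus_lip0.rep_eq lip0_apply_mult_lip0[OF mu(1)] lip0_apply_mult_lip0[OF mu(2)]
          algebra_simps)
    then have "pairing \<mu> f = pairing \<mu> (mult_lip0 u f) + pairing \<mu> (mult_lip0 (\<lambda>x. 1 - u x) f)"
      by (metis pairing_simps(5))
    ultimately have "\<epsilon> / 2 < pairing \<mu> (mult_lip0 u f)"
      using f(2) by linarith
    moreover have "norm (mult_lip0 u f) \<le> (L + 1) * 1"
      using f(1) L by (intro order_trans[OF norm_mult_lip0_le[OF mu(1)]] mult_left_mono) auto
    moreover have "u x = 0" if "x \<notin> expansion \<delta> E'" for x
      unfolding u_def using \<delta> that by (intro cutoff_eq_0) auto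
    ultimately show ?thesis
      using f0(1) f(3) E S(1)
      by (intro exI[of _ E'] exI[of _ \<mu>] exI[of _ "mult_lip0 u f"])
        (auto simp: Q_def E'_def lip0_apply_mult_lip0[OF mu(1)])
  qed
  then have "\<forall>E. \<exists>E' \<mu> g. finite E \<and> 0 \<in> E \<longrightarrow> Q E E' \<mu> g" by blast
  then obtain E' \<mu> g where Q: "finite E \<and> 0 \<in> E \<Longrightarrow> Q E (E' E) (\<mu> E) (g E)" for E
    by metis
  define F where "F n = (E' ^^ n) {0}" for n
  have F_Suc: "F (Suc n) = E' (F n)" for n by (simp add: F_def)
  have F: "finite (F n) \<and> 0 \<in> F n" for n
    using Q by (induction n) (simp_all add: F_def Q_def)
  have QF: "Q (F n) (F (Suc n)) (\<mu> (F n)) (g (F n))" for n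
    using Q[OF F] by (simp add: F_Suc)
  have "F n \<subseteq> F (Suc n)" for n using QF[of n] by (simp add: Q_def)
  then have Fmono: "F m \<subseteq> F n" if "m \<le> n" for m n
    using that by (rule lift_Suc_mono_le)
  have disj: "lip0_apply (g (F n)) x = 0" if "m < n" "lip0_apply (g (F m)) x \<noteq> 0" for m n x
  proof -
    have "x \<in> expansion \<delta> (F (Suc m))"
      using QF[of m] that(2) by (auto simp: Q_def)
    also have "\<dots> \<subseteq> expansion \<delta> (F n)"
      using that(1) F[of "Suc m"] \<delta> by (intro expansion_mono Fmono) auto
    finally show ?thesis using QF[of n] by (simp add: Q_def)
  qed
  show False
  proof (rule weakly_precompact_disjoint_bumps_False[OF W])
    show "\<mu> (F n) \<in> W" "norm (g (F n)) \<le> L + 1" "\<epsilon> / 2 < pairing (\<mu> (F n)) (g (F n))" for n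
      using QF[of n] by (auto simp: Q_def)
    show "m = n" if "lip0_apply (g (F m)) x \<noteq> 0" "lip0_apply (g (F n)) x \<noteq> 0" for m n x
      using disj[of m n x] disj[of n m x] that by (cases m n rule: linorder_cases) auto
  qed (use \<epsilon> in simp)
qed

section \<open>Compact reduction\<close>

text \<open>Finitely many initial terms can be added as further centres, so the whole range is
  totally bounded. Closed balls of half the radius cover its closure too.\<close>

lemma totally_bounded_tails_subconvergent:
  fixes x :: "nat \<Rightarrow> 'a::complete_space"
  assumes "\<And>e. 0 < e \<Longrightarrow> \<exists>S. finite S \<and> (\<forall>\<^sub>F n in sequentially. x n \<in> (\<Union>s\<in>S. cball s e))"
  obtains l r where "strict_mono r" "(x \<circ> r) \<longlonglongrightarrow> l"
proof -
  have "compact (closure (range x))"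
    unfolding compact_eq_totally_bounded
  proof (intro conjI allI impI)
    show "complete (closure (range x))" by (simp add: complete_eq_closed)
    fix e :: real assume e: "0 < e"
    then obtain S where S: "finite S" "\<forall>\<^sub>F n in sequentially. x n \<in> (\<Union>s\<in>S. cball s (e / 2))"
      using assms[of "e / 2"] by auto
    from S(2) obtain N where N: "\<And>n. N \<le> n \<Longrightarrow> x n \<in> (\<Union>s\<in>S. cball s (e / 2))"
      by (auto simp: eventually_sequentially)
    define k where "k = S \<union> x ` {..<N}"
    have "x n \<in> (\<Union>s\<in>k. cball s (e / 2))" for n
    proof (cases "N \<le> n")
      case True
      then show ?thesis using N[of n] by (auto simp: k_def)
    next
      case False
      then have "x n \<in> k" by (simp add: k_def)
      moreover have "x n \<in> cball (x n) (e / 2)" using e by simp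
      ultimately show ?thesis by blast
    qed
    then have "range x \<subseteq> (\<Union>s\<in>k. cball s (e / 2))" by blast
    then have "closure (range x) \<subseteq> (\<Union>s\<in>k. cball s (e / 2))"
      using S(1) by (intro closure_minimal closed_UN) (simp_all add: k_def)
    also have "\<dots> \<subseteq> (\<Union>s\<in>k. ball s e)"
      using e by (intro UN_mono) auto
    finally show "\<exists>k. finite k \<and> closure (range x) \<subseteq> (\<Union>s\<in>k. ball s e)"
      using S(1) by (intro exI[of _ k]) (simp add: k_def)
  qed
  moreover have "x n \<in> closure (range x)" for n
    by (rule subsetD[OF closure_subset]) simp
  ultimately have "\<exists>l\<in>closure (range x). \<exists>r. strict_mono r \<and> (x \<circ> r) \<longlonglongrightarrow> l"
    unfolding compact_def by simp
  then show thesis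
    using that by blast
qed

text \<open>One expansion with small parameter bounds the tail of the sequence. On a bounded region
  the scaled neighbourhoods are contained in finite unions of balls of small radius, so a
  subsequence converges, and the limit stays in the closed expansions. This serves both for the
  compactness of the intersection and for points taken from the supports of late products.\<close>

lemma expansions_subconvergent:
  fixes x :: "nat \<Rightarrow> 'a::{complete_space, zero}"
  assumes E: "\<And>i. finite (E i)" "\<And>i. 0 \<in> E i" and \<eta>: "\<eta> \<longlonglongrightarrow> 0"
    and x: "\<And>i. \<forall>\<^sub>F n in sequentially. x n \<in> expansion (\<eta> i) (E i)"
  obtains l r where "strict_mono r" "(x \<circ> r) \<longlonglongrightarrow> l" "l \<in> (\<Inter>i. expansion (\<eta> i) (E i))"
proof -
  have ex_less: "\<exists>i. \<eta> i < c" if "0 < c" for c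
    using order_tendstoD(2)[OF \<eta> that] by (auto simp: eventually_sequentially)
  \<comment> \<open>A parameter below \<open>1 / 2\<close> lets the term growing with
    \<open>dist y 0\<close> be absorbed on the left, which yields the bound
    \<open>2 * D + 1\<close>.\<close>
  obtain i0 where i0: "\<eta> i0 < 1 / 2" using ex_less[of "1 / 2"] by auto
  define D where "D = (\<Sum>e\<in>E i0. dist e 0)"
  define R where "R = 2 * D + 1"
  have R: "dist y 0 \<le> R" if "y \<in> expansion (\<eta> i0) (E i0)" for y
  proof -
    have "dist y 0 - D \<le> dist y e" if "e \<in> E i0" for e
    proof -
      have "dist e 0 \<le> D" unfolding D_def using E that by (intro member_le_sum) auto
      then show ?thesis using dist_triangle[of y 0 e] by simp
    qed
    then have "dist y 0 - D \<le> infdist y (E i0)"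
      using E(2)[of i0] by (auto simp: infdist_def intro!: cINF_greatest)
    also have "\<dots> \<le> \<eta> i0 * (1 + dist y 0)" using that by (simp add: expansion_def)
    also have "\<dots> \<le> 1 / 2 * (1 + dist y 0)"
      using i0 one_plus_dist_pos[of y 0] by (intro mult_right_mono) auto
    finally show ?thesis by (simp add: R_def)
  qed
  have "0 \<le> R" by (simp add: R_def D_def sum_nonneg)
  obtain l r where lr: "strict_mono r" "(x \<circ> r) \<longlonglongrightarrow> l"
  proof (rule totally_bounded_tails_subconvergent)
    fix e :: real assume e: "0 < e"
    with \<open>0 \<le> R\<close> obtain i where i: "\<eta> i < e / (1 + R)" using ex_less[of "e / (1 + R)"] by auto
    have "\<forall>\<^sub>F n in sequentially. x n \<in> (\<Union>s\<in>E i. cball s e)"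
      using x[of i] x[of i0]
    proof eventually_elim
      case (elim n)
      have "infdist (x n) (E i) \<le> \<eta> i * (1 + dist (x n) 0)"
        using elim(1) by (simp add: expansion_def)
      also have "\<dots> \<le> e / (1 + R) * (1 + dist (x n) 0)"
        using i one_plus_dist_pos[of "x n" 0] by (intro mult_right_mono) auto
      also have "\<dots> \<le> e / (1 + R) * (1 + R)"
        using R[OF elim(2)] e \<open>0 \<le> R\<close> by (intro mult_left_mono) auto
      also have "\<dots> = e" using \<open>0 \<le> R\<close> by simp
      finally have "infdist (x n) (E i) \<le> e" .
      \<comment> \<open>The distance to a finite nonempty set is attained, which provides an actual
        centre.\<close>
      moreover have "infdist (x n) (E i) \<in> dist (x n) ` E i"
      proof -
        have "E i \<noteq> {}" using E(2)[of i] by blast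
        then show ?thesis
          using E(1)[of i] by (simp add: infdist_def cInf_eq_Min)
      qed
      ultimately show ?case by (auto simp: dist_commute)
    qed
    with E(1) show "\<exists>S. finite S \<and> (\<forall>\<^sub>F n in sequentially. x n \<in> (\<Union>s\<in>S. cball s e))" by blast
  qed
  have "l \<in> expansion (\<eta> i) (E i)" for i
  proof (rule Lim_in_closed_set[OF closed_expansion _ _ lr(2)])
    show "\<forall>\<^sub>F n in sequentially. (x \<circ> r) n \<in> expansion (\<eta> i) (E i)"
      using eventually_subseq[OF lr(1) x[of i]] by simp
  qed simp
  with lr show thesis by (intro that) auto
qed

text \<open>Truncation to the interval from \<open>- s\<close> to \<open>s\<close> does not increase
  the Lipschitz constant. It replaces a function that is small only on the support of a cutoff by
  one that is small everywhere.\<close>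

lemma exists_clip:
  assumes "0 \<le> s"
  obtains g where "norm g \<le> norm f" "\<And>x. \<bar>lip0_apply g x\<bar> \<le> s"
    "\<And>x. \<bar>lip0_apply f x\<bar> \<le> s \<Longrightarrow> lip0_apply g x = lip0_apply f x"
proof -
  define c where "c x = max (- s) (min s (lip0_apply f x))" for x
  have lip: "(norm f)-lipschitz_on UNIV c"
  proof (rule lipschitz_onI)
    fix x y
    have "dist (c x) (c y) \<le> dist (lip0_apply f x) (lip0_apply f y)"
      by (auto simp: c_def dist_real_def)
    also have "\<dots> \<le> norm f * dist x y"
      by (rule lipschitz_onD[OF lipschitz_on_norm_lip0]) auto
    finally show "dist (c x) (c y) \<le> norm f * dist x y" .
  qed simp
  moreover have "c 0 = 0" using assms by (simp add: c_def)
  ultimately have app: "lip0_apply (Lip0 c) x = c x" for x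
    by (subst Lip0_inverse) auto
  show thesis
  proof (rule that[of "Lip0 c"])
    show "norm (Lip0 c) \<le> norm f" using lip by (intro norm_lip0_le) (simp add: app)
  qed (use assms in \<open>auto simp: app c_def\<close>)
qed

lemma weakly_precompact_compact_reduction:
  fixes W :: "'a::{complete_space, zero} lip_free set"
  assumes W: "weakly_precompact W" and \<epsilon>: "0 < \<epsilon>"
  shows "\<exists>(K :: 'a set) (T :: 'a lip_free \<Rightarrow> 'a lip_free).
       compact K \<and>
       linear_on_subspace (span W) T \<and> T ` span W \<subseteq> free_over K \<and>
       (\<forall>\<mu>\<in>W. norm (\<mu> - T \<mu>) \<le> \<epsilon>) \<and>
       (\<exists>Tk :: nat \<Rightarrow> ('a lip_free \<Rightarrow>\<^sub>L 'a lip_free).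
          uniform_limit W (\<lambda>k. blinfun_apply (Tk k)) T sequentially)"
proof -
  define \<delta> :: "nat \<Rightarrow> real" where "\<delta> i = (1 / 2) ^ i" for i
  have \<delta>: "0 < \<delta> i" for i by (simp add: \<delta>_def)
  define L where "L i = 1 / \<delta> i + 4" for i
  have L: "0 \<le> L i" for i using \<delta>[of i] by (simp add: L_def)
  \<comment> \<open>\<open>C k\<close> bounds the norm of multiplication by the product
    \<open>H k\<close> of the first \<open>k\<close> cutoffs.\<close>
  define C where "C k = (\<Sum>i<k. L i) + 1" for k
  have C: "0 < C k" for k by (simp add: C_def sum_nonneg L add_nonneg_pos)
  \<comment> \<open>Chosen so that the step from \<open>k\<close> to \<open>Suc k\<close> errs by at
    most \<open>\<epsilon> * (1 / 2) ^ Suc k\<close>. As \<open>L\<close> and \<open>C\<close>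
    depend on \<open>\<delta>\<close> alone, all sets \<open>E k\<close> can be chosen
    simultaneously.\<close>
  define \<epsilon>' where "\<epsilon>' k = \<epsilon> * (1 / 2) ^ Suc k / ((L k + 1) * C k)" for k
  have \<epsilon>': "0 < \<epsilon>' k" for k
    using \<epsilon> C[of k] L[of k] by (simp add: \<epsilon>'_def)
  have "\<exists>E. finite E \<and> 0 \<in> E \<and> (\<forall>\<mu>\<in>W. \<forall>f. (\<forall>x\<in>expansion (\<delta> k) E. lip0_apply f x = 0) \<longrightarrow>
    \<bar>pairing \<mu> f\<bar> \<le> \<epsilon>' k * norm f)" for k
    by (rule weakly_precompact_concentrated[OF W \<delta> \<epsilon>'])
  then obtain E where E: "\<And>k. finite (E k)" "\<And>k. 0 \<in> E k"
    "\<And>k \<mu> f. \<mu> \<in> W \<Longrightarrow> (\<And>x. x \<in> expansion (\<delta> k) (E k) \<Longrightarrow> lip0_apply f x = 0) \<Longrightarrow>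
      \<bar>pairing \<mu> f\<bar> \<le> \<epsilon>' k * norm f"
    by metis
  define h where "h i = cutoff (\<delta> i) (E i)" for i
  define H where "H k x = (\<Prod>i<k. h i x)" for k x
  define K where "K = (\<Inter>i. expansion (2 * \<delta> i) (E i))"
  have mh: "multiplier (L i) (h i)" "multiplier (L i) (\<lambda>x. 1 - h i x)" for i
    unfolding L_def h_def
    by (auto intro!: multiplier_cutoff multiplier_one_minus \<delta> simp: cutoff_bounds)
  have mH: "multiplier (\<Sum>i<k. L i) (H k)" for k
    unfolding H_def using mh(1) by (intro multiplier_prod) auto
  note app = lip0_apply_mult_lip0[OF mH] lip0_apply_mult_lip0[OF mh(2)]
  have "\<forall>k. \<exists>T :: 'a lip_free \<Rightarrow>\<^sub>L 'a lip_free.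
      \<forall>\<mu> f. pairing (T \<mu>) f = pairing \<mu> (mult_lip0 (H k) f)"
    using exists_preadjoint_mult_lip0[OF mH] by blast
  then obtain Tk :: "nat \<Rightarrow> 'a lip_free \<Rightarrow>\<^sub>L 'a lip_free"
    where Tk: "\<And>k \<mu> f. pairing (Tk k \<mu>) f = pairing \<mu> (mult_lip0 (H k) f)"
    by metis
  \<comment> \<open>The empty product is 1, so the operators start from the identity; the error
    bound at index 0 thus becomes the bound on \<open>\<mu> - T \<mu>\<close>.\<close>
  have Tk0: "Tk 0 \<mu> = \<mu>" for \<mu>
  proof -
    have "mult_lip0 (H 0) f = f" for f
      by (rule lip0_eqI) (simp add: app, simp add: H_def)
    then show ?thesis by (intro lip_free_eqI) (simp add: Tk)
  qed
  \<comment> \<open>Consecutive products differ by \<open>(1 - h k) * H k\<close>, which vanishes on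
    the expansion of \<open>E k\<close> with parameter \<open>\<delta> k\<close>, where
    \<open>h k\<close> is 1.\<close>
  have Tk_step: "norm (Tk k \<mu> - Tk (Suc k) \<mu>) \<le> \<epsilon> * (1 / 2) ^ Suc k" if "\<mu> \<in> W" for k \<mu>
  proof (rule norm_lip_free_le)
    show "0 \<le> \<epsilon> * (1 / 2) ^ Suc k" using \<epsilon> by simp
    fix f :: "'a lip0"
    define F where "F = mult_lip0 (\<lambda>x. 1 - h k x) (mult_lip0 (H k) f)"
    have "mult_lip0 (H k) f - mult_lip0 (H (Suc k)) f = F"
      by (rule lip0_eqI)
        (simp add: F_def minus_lip0.rep_eq app, simp add: H_def algebra_simps)
    then have "\<bar>pairing (Tk k \<mu> - Tk (Suc k) \<mu>) f\<bar> = \<bar>pairing \<mu> F\<bar>"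
      by (simp add: pairing_simps(2) Tk flip: pairing_simps(6))
    also have "\<dots> \<le> \<epsilon>' k * norm F"
      by (intro E(3)[OF that]) (simp add: F_def app, simp add: h_def cutoff_eq_1[OF \<delta>])
    also have "\<dots> \<le> \<epsilon>' k * ((L k + 1) * (C k * norm f))"
      unfolding F_def C_def using L[of k] \<epsilon>'[of k]
      by (intro mult_left_mono order_trans[OF norm_mult_lip0_le[OF mh(2)]] norm_mult_lip0_le[OF mH])
        auto
    also have "\<dots> = \<epsilon> * (1 / 2) ^ Suc k * norm f"
      using C[of k] L[of k] by (simp add: \<epsilon>'_def)
    finally show "\<bar>pairing (Tk k \<mu> - Tk (Suc k) \<mu>) f\<bar> \<le> \<epsilon> * (1 / 2) ^ Suc k * norm f" .
  qed
  \<comment> \<open>Keeping the bound as a difference of powers makes the induction close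
    exactly.\<close>
  have tele: "norm (Tk m \<mu> - Tk n \<mu>) \<le> \<epsilon> * ((1 / 2) ^ m - (1 / 2) ^ n)"
    if "\<mu> \<in> W" "m \<le> n" for m n \<mu>
    using that(2)
  proof (induction n rule: dec_induct)
    case (step n)
    have "norm (Tk m \<mu> - Tk (Suc n) \<mu>) \<le>
        norm (Tk m \<mu> - Tk n \<mu>) + norm (Tk n \<mu> - Tk (Suc n) \<mu>)"
      using norm_triangle_ineq[of "Tk m \<mu> - Tk n \<mu>" "Tk n \<mu> - Tk (Suc n) \<mu>"] by simp
    also have "\<dots> \<le> \<epsilon> * ((1 / 2) ^ m - (1 / 2) ^ n) + \<epsilon> * (1 / 2) ^ Suc n"
      by (intro add_mono step.IH Tk_step that(1))
    also have "\<dots> = \<epsilon> * ((1 / 2) ^ m - (1 / 2) ^ Suc n)" by (simp add: algebra_simps)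
    finally show ?case .
  qed simp
  have tele': "norm (Tk m \<mu> - Tk n \<mu>) \<le> \<epsilon> * (1 / 2) ^ m" if "\<mu> \<in> W" "m \<le> n" for m n \<mu>
  proof -
    have "\<epsilon> * ((1 / 2) ^ m - (1 / 2) ^ n) \<le> \<epsilon> * (1 / 2) ^ m"
      using \<epsilon> by (intro mult_left_mono) auto
    with tele[OF that] show ?thesis by linarith
  qed
  have geo: "(\<lambda>m. \<epsilon> * (1 / 2) ^ m) \<longlonglongrightarrow> 0"
    by (intro tendsto_mult_right_zero LIMSEQ_power_zero) simp
  have convW: "convergent (\<lambda>k. Tk k \<mu>)" if "\<mu> \<in> W" for \<mu>
  proof -
    have "Cauchy (\<lambda>k. Tk k \<mu>)"
      unfolding Cauchy_altdef
    proof (intro allI impI)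
      fix e :: real assume "0 < e"
      with order_tendstoD(2)[OF geo] obtain M where M: "\<And>m. M \<le> m \<Longrightarrow> \<epsilon> * (1 / 2) ^ m < e"
        by (force simp: eventually_sequentially)
      have "dist (Tk m \<mu>) (Tk n \<mu>) < e" if "M \<le> m" "m < n" for m n
        using tele'[OF \<open>\<mu> \<in> W\<close>, of m n] M[of m] that by (simp add: dist_norm)
      then show "\<exists>M. \<forall>m\<ge>M. \<forall>n>m. dist (Tk m \<mu>) (Tk n \<mu>) < e" by blast
    qed
    then show ?thesis by (rule Cauchy_convergent)
  qed
  \<comment> \<open>The limit is known to exist on \<open>span W\<close> only; elsewhere
    \<open>lim\<close> may be an arbitrary value.\<close>
  define T where "T \<mu> = lim (\<lambda>k. Tk k \<mu>)" for \<mu>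
  have conv: "convergent (\<lambda>k. Tk k \<mu>)" if "\<mu> \<in> span W" for \<mu>
    using that
  proof (induction rule: span_induct_alt)
    case (step c \<nu> \<rho>)
    then obtain l l' where "(\<lambda>k. Tk k \<nu>) \<longlonglongrightarrow> l" "(\<lambda>k. Tk k \<rho>) \<longlonglongrightarrow> l'"
      using convW unfolding convergent_def by blast
    then have "(\<lambda>k. Tk k (c *\<^sub>R \<nu> + \<rho>)) \<longlonglongrightarrow> c *\<^sub>R l + l'"
      unfolding blinfun.bilinear_simps by (intro tendsto_intros)
    then show ?case by (rule convergentI)
  qed (simp add: convergent_const)
  have T: "(\<lambda>k. Tk k \<mu>) \<longlonglongrightarrow> T \<mu>" if "\<mu> \<in> span W" for \<mu>
    using conv[OF that] by (simp add: T_def convergent_LIMSEQ_iff)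
  have TW: "norm (Tk m \<mu> - T \<mu>) \<le> \<epsilon> * (1 / 2) ^ m" if "\<mu> \<in> W" for m \<mu>
  proof (rule Lim_bounded)
    show "(\<lambda>n. norm (Tk m \<mu> - Tk n \<mu>)) \<longlonglongrightarrow> norm (Tk m \<mu> - T \<mu>)"
      using that by (intro tendsto_intros T span_base)
    show "\<forall>n\<ge>m. norm (Tk m \<mu> - Tk n \<mu>) \<le> \<epsilon> * (1 / 2) ^ m"
      using tele'[OF that] by blast
  qed
  have lin: "linear_on_subspace (span W) T"
    unfolding linear_on_subspace_def
  proof (intro conjI ballI allI)
    fix \<mu> \<nu> c assume \<mu>: "\<mu> \<in> span W"
    show "T (\<mu> + \<nu>) = T \<mu> + T \<nu>" if "\<nu> \<in> span W"
      using LIMSEQ_unique[OF T[OF span_add[OF \<mu> that]]] tendsto_add[OF T[OF \<mu>] T[OF that]]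
      by (simp add: blinfun.add_right)
    show "T (c *\<^sub>R \<mu>) = c *\<^sub>R T \<mu>"
      using LIMSEQ_unique[OF T[OF span_scale[OF \<mu>]]] tendsto_scaleR[OF tendsto_const T[OF \<mu>]]
      by (simp add: blinfun.scaleR_right)
  qed
  have \<delta>0: "(\<lambda>i. 2 * \<delta> i) \<longlonglongrightarrow> 0"
    unfolding \<delta>_def by (intro tendsto_mult_right_zero LIMSEQ_power_zero) simp
  have "compact K"
    unfolding compact_def
  proof (intro allI impI)
    fix x :: "nat \<Rightarrow> 'a" assume "\<forall>n. x n \<in> K"
    then have "\<forall>\<^sub>F n in sequentially. x n \<in> expansion (2 * \<delta> i) (E i)" for i
      by (simp add: K_def)
    from expansions_subconvergent[OF E(1,2) \<delta>0 this]
    show "\<exists>l\<in>K. \<exists>r. strict_mono r \<and> (x \<circ> r) \<longlonglongrightarrow> l"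
      unfolding K_def by metis
  qed
  \<comment> \<open>Otherwise points of the supports with \<open>\<bar>f\<bar>\<close> above
    \<open>s\<close> would accumulate at a point of \<open>K\<close>, where \<open>f\<close>
    vanishes, against continuity.\<close>
  have near: "\<exists>k. \<forall>x. H k x \<noteq> 0 \<longrightarrow> \<bar>lip0_apply f x\<bar> \<le> s"
    if f: "\<And>x. x \<in> K \<Longrightarrow> lip0_apply f x = 0" and s: "0 < s" for f s
  proof (rule ccontr)
    assume "\<not> ?thesis"
    then have "\<forall>k. \<exists>x. H k x \<noteq> 0 \<and> s < \<bar>lip0_apply f x\<bar>" by (simp add: not_le)
    then obtain x where x: "\<And>k. H k (x k) \<noteq> 0" "\<And>k. s < \<bar>lip0_apply f (x k)\<bar>" by metis
    \<comment> \<open>The factor \<open>h i\<close> enters the product \<open>H n\<close> from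
      \<open>n = Suc i\<close> on.\<close>
    have "x n \<in> expansion (2 * \<delta> i) (E i)" if "Suc i \<le> n" for i n
    proof (rule ccontr)
      assume "x n \<notin> expansion (2 * \<delta> i) (E i)"
      then have "h i (x n) = 0" unfolding h_def by (rule cutoff_eq_0[OF \<delta>])
      with that have "H n (x n) = 0" by (auto simp: H_def)
      with x(1) show False by blast
    qed
    then have "\<forall>\<^sub>F n in sequentially. x n \<in> expansion (2 * \<delta> i) (E i)" for i
      unfolding eventually_sequentially by blast
    from expansions_subconvergent[OF E(1,2) \<delta>0 this]
    obtain l r where lr: "(x \<circ> r) \<longlonglongrightarrow> l" "l \<in> K"
      unfolding K_def by metis
    have "continuous_on UNIV (lip0_apply f)"
      by (rule lipschitz_on_continuous_on[OF lipschitz_on_norm_lip0])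
    then have "(\<lambda>n. lip0_apply f ((x \<circ> r) n)) \<longlonglongrightarrow> lip0_apply f l"
      by (rule continuous_on_tendsto_compose[OF _ lr(1)]) auto
    then have "(\<lambda>n. \<bar>lip0_apply f ((x \<circ> r) n)\<bar>) \<longlonglongrightarrow> 0"
      using f[OF lr(2)] by (simp add: tendsto_rabs_zero)
    then have "s \<le> 0"
      using less_imp_le[OF x(2)] by (intro LIMSEQ_le_const) auto
    with s show False by simp
  qed
  \<comment> \<open>For \<open>f\<close> vanishing on \<open>K\<close>, a clipped \<open>g\<close>
    agrees with \<open>f\<close> on the supports of late products, so \<open>T \<mu>\<close> takes
    the same value on both. That value is small because \<open>g\<close> is small everywhere and
    \<open>T \<mu>\<close> sees finitely many points up to \<open>\<eta>\<close>.\<close>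
  have range: "T \<mu> \<in> free_over K" if \<mu>: "\<mu> \<in> span W" for \<mu>
  proof (rule mem_free_overI)
    fix f assume f: "\<And>x. x \<in> K \<Longrightarrow> lip0_apply f x = 0"
    have "\<bar>pairing (T \<mu>) f\<bar> \<le> 0 + e" if e: "0 < e" for e
    proof -
      define \<eta> where "\<eta> = e / (norm f + 1)"
      have \<eta>: "0 < \<eta>" using e by (simp add: \<eta>_def add_nonneg_pos)
      obtain S D where SD: "finite S" "0 \<le> D" "\<And>g s. 0 \<le> s \<Longrightarrow>
        (\<And>x. x \<in> S \<Longrightarrow> \<bar>lip0_apply g x\<bar> \<le> s) \<Longrightarrow> \<bar>pairing (T \<mu>) g\<bar> \<le> \<eta> * norm g + D * s"
        using pairing_approx[OF \<eta>, of "T \<mu>"] by blast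
      define s where "s = \<eta> / (D + 1)"
      have s: "0 < s" using \<eta> SD(2) by (simp add: s_def)
      have "D * s \<le> (D + 1) * s" using s by simp
      also have "\<dots> = \<eta>" using SD(2) by (simp add: s_def)
      finally have Ds: "D * s \<le> \<eta>" .
      obtain g where g: "norm g \<le> norm f" "\<And>x. \<bar>lip0_apply g x\<bar> \<le> s"
        "\<And>x. \<bar>lip0_apply f x\<bar> \<le> s \<Longrightarrow> lip0_apply g x = lip0_apply f x"
        using exists_clip[of s f] s by auto
      obtain k where k: "\<And>x. H k x \<noteq> 0 \<Longrightarrow> \<bar>lip0_apply f x\<bar> \<le> s"
        using near[OF f s] by blast
      have "pairing (Tk n \<mu>) (f - g) = 0" if "k \<le> n" for n
      proof -
        have "H n x * lip0_apply (f - g) x = 0" for x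
        proof (cases "H k x = 0")
          case True
          then obtain i where "i < k" "h i x = 0" by (auto simp: H_def)
          with \<open>k \<le> n\<close> have "H n x = 0" by (auto simp: H_def intro!: bexI[of _ i])
          then show ?thesis by simp
        next
          case False
          then show ?thesis using g(3)[OF k[OF False]] by (simp add: minus_lip0.rep_eq)
        qed
        then have "mult_lip0 (H n) (f - g) = 0"
          by (intro lip0_eqI) (simp add: app zero_lip0.rep_eq)
        then show ?thesis by (simp only: Tk pairing_simps(8))
      qed
      then have "\<forall>\<^sub>F n in sequentially. pairing (Tk n \<mu>) (f - g) = 0"
        unfolding eventually_sequentially by blast
      then have "(\<lambda>n. pairing (Tk n \<mu>) (f - g)) \<longlonglongrightarrow> 0"
        by (rule tendsto_eventually)
      from LIMSEQ_unique[OF this tendsto_pairing[OF T[OF \<mu>]]]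
      have "pairing (T \<mu>) f = pairing (T \<mu>) g" by (simp add: pairing_simps)
      also have "\<bar>\<dots>\<bar> \<le> \<eta> * norm g + D * s" using s by (intro SD(3) g(2)) simp
      also have "\<dots> \<le> \<eta> * norm f + \<eta>"
        using g(1) \<eta> Ds by (intro add_mono mult_left_mono) auto
      also have "\<dots> = \<eta> * (norm f + 1)" by (simp add: algebra_simps)
      also have "\<dots> = e" using add_nonneg_pos[OF norm_ge_zero[of f] zero_less_one] by (simp add: \<eta>_def)
      finally show ?thesis by simp
    qed
    then have "\<bar>pairing (T \<mu>) f\<bar> \<le> 0" by (rule field_le_epsilon)
    then show "pairing (T \<mu>) f = 0" by simp
  qed
  have "uniform_limit W (\<lambda>k. blinfun_apply (Tk k)) T sequentially"
  proof (rule uniform_limitI)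
    fix e :: real assume "0 < e"
    from order_tendstoD(2)[OF geo this]
    show "\<forall>\<^sub>F k in sequentially. \<forall>\<mu>\<in>W. dist (Tk k \<mu>) (T \<mu>) < e"
      by eventually_elim (auto simp: dist_norm intro: le_less_trans[OF TW])
  qed
  moreover have "\<forall>\<mu>\<in>W. norm (\<mu> - T \<mu>) \<le> \<epsilon>"
    using TW[of _ 0] by (simp add: Tk0)
  ultimately show ?thesis
    using \<open>compact K\<close> lin range by blast
qed

theorem theorem2p3:
  fixes W :: "'a::{complete_space, zero} lip_free set"
  assumes "weakly_precompact W"
  shows "tight W \<and>
    (\<forall>\<epsilon>>0. \<exists>(K :: 'a set) (T :: 'a lip_free \<Rightarrow> 'a lip_free).
       compact K \<and>
       linear_on_subspace (span W) T \<and> T ` span W \<subseteq> free_over K \<and>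
       (\<forall>\<mu>\<in>W. norm (\<mu> - T \<mu>) \<le> \<epsilon>) \<and>
       (\<exists>Tk :: nat \<Rightarrow> ('a lip_free \<Rightarrow>\<^sub>L 'a lip_free).
          uniform_limit W (\<lambda>k. blinfun_apply (Tk k)) T sequentially))"
proof
  show "tight W"
    unfolding tight_def
  proof (intro allI impI)
    fix \<epsilon> :: real assume \<epsilon>: "0 < \<epsilon>"
    obtain K :: "'a set" and T :: "'a lip_free \<Rightarrow> 'a lip_free"
      where KT: "compact K" "T ` span W \<subseteq> free_over K" "\<forall>\<mu>\<in>W. norm (\<mu> - T \<mu>) \<le> \<epsilon>"
      using weakly_precompact_compact_reduction[OF assms \<epsilon>] by blast
    have "\<mu> \<in> {\<nu> + \<epsilon> *\<^sub>R \<beta> | \<nu> \<beta>. \<nu> \<in> free_over K \<and> \<beta> \<in> cball 0 1}" if "\<mu> \<in> W" for \<mu>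
    proof -
      \<comment> \<open>The error of \<open>T\<close> at \<open>\<mu>\<close>, rescaled into the
        unit ball.\<close>
      define \<beta> where "\<beta> = inverse \<epsilon> *\<^sub>R (\<mu> - T \<mu>)"
      have "\<mu> = T \<mu> + \<epsilon> *\<^sub>R \<beta>" using \<epsilon> by (simp add: \<beta>_def)
      moreover have "T \<mu> \<in> free_over K" using KT(2) that by (auto intro: span_base)
      moreover have "\<beta> \<in> cball 0 1"
        using KT(3) that \<epsilon> unfolding \<beta>_def mem_cball_0 norm_scaleR by (simp add: field_simps)
      ultimately show ?thesis by blast
    qed
    with KT(1) show "\<exists>K. compact K \<and>
        W \<subseteq> {\<nu> + \<epsilon> *\<^sub>R \<beta> | \<nu> \<beta>. \<nu> \<in> free_over K \<and> \<beta> \<in> cball 0 1}"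
      by blast
  qed
qed (use weakly_precompact_compact_reduction[OF assms] in blast)

end
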